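(* Let $p$ be a prime and let $f:\mathbb{Z}_p\to\mathbb{Q}_p$ be a $p$-adic locally analytic function. Then there exist $m_0\in\mathbb{N}_+$ and $\mu\in\mathbb{N}$ such that for every integer $m\geq m_0$ there are exactly $\mu$ non-constant congruence classes $[a]_{p^m}$ modulo $p^m$ with respect to the sequence $(f(n))_{n\in\mathbb{N}_+}$, and each non-constant class $[a]_{p^m}$ splits into $p-1$ constant classes $[a_1]_{p^{m+1}},\dots,[a_{p-1}]_{p^{m+1}}$ modulo $p^{m+1}$ with $p$-adic valuation equal to $\min v_p(f([a]_{p^m}))$ and one non-constant class $[a_0]_{p^{m+1}}$ modulo $p^{m+1}$ with $\min v_p(f([a_0]_{p^{m+1}}))>\min v_p(f([a]_{p^m}))$. More precisely, for each non-constant class $[a]_{p^{m_0}}$ modulo $p^{m_0}$ there are $\beta\in\mathbb{Z}$, $l\in\mathbb{N}_+$ and $x_0\in\mathbb{Z}_p$ such that $v_p(f(n))=\beta+l\,v_p(n-x_0)$ for all $n\in[a]_{p^{m_0}}$. In particular, for each non-constant class $[a]_{p^{m_0}}$ there are $\alpha\in\mathbb{Z}$ and $l\in\mathbb{N}_+$ such that for each $m\geq m_0$ the least $p$-adic valuation of the unique non-constant class modulo $p^m$ contained in $[a]_{p^{m_0}}$ equals $\alpha+l(m-m_0)$.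
   Context: $v_p$ is the $p$-adic valuation on $\mathbb{Q}_p$, $v_p(0)=+\infty$. A function $f:\mathbb{Z}_p\to\mathbb{Q}_p$ is $p$-adic locally analytic if every $x_0\in\mathbb{Z}_p$ has a neighbourhood on which $f(x)=\sum_{n\ge0}a_n(x-x_0)^n$ for some $a_n\in\mathbb{Q}_p$ (convergent). For integers $a$, $d\ge1$: $[a]_d=\{n\in\mathbb{Z}: n\equiv a\pmod d\}$, $f([a]_d)=\{f(n): n\in[a]_d,\ n\in\mathbb{N}_+\}$, $v_p(f([a]_d))=\{v_p(f(n)): n\in[a]_d, n\in\mathbb{N}_+\}$. A class $[a]_d$ is constant with $p$-adic valuation $t$ (with respect to $(f(n))_{n\in\mathbb{N}_+}$) if $v_p(f(n))=t$ for every positive $n\in[a]_d$; otherwise it is non-constant. $\mathbb{N}=\{0,1,\dots\}$, $\mathbb{N}_+=\{1,2,\dots\}$. *)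

theory Defs
  imports "HOL-Analysis.Analysis" "Berlekamp_Zassenhaus.Finite_Field"
begin

section \<open>The $p$-adic valuation on the rationals\<close>

definition rat_val :: "nat \<Rightarrow> rat \<Rightarrow> ereal" where
  "rat_val p x =
    (if x = 0 then \<infinity>
     else ereal (real (multiplicity (int p) (fst (quotient_of x)))
               - real (multiplicity (int p) (snd (quotient_of x)))))"

lemma rat_val_0 [simp]: "rat_val p 0 = \<infinity>"
  by (simp add: rat_val_def)

lemma rat_val_1 [simp]: "rat_val p 1 = 0"
  by (simp add: rat_val_def zero_ereal_def)

lemma rat_val_not_MInf [simp]: "rat_val p x \<noteq> -\<infinity>"
  by (simp add: rat_val_def)

lemma rat_val_eq_PInf_iff [simp]: "rat_val p x = \<infinity> \<longleftrightarrow> x = 0"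
  by (simp add: rat_val_def)

lemma rat_val_of_int:
  "rat_val p (of_int n) = (if n = 0 then \<infinity> else ereal (real (multiplicity (int p) n)))"
  by (simp add: rat_val_def)

lemma rat_val_divide_of_int:
  assumes p: "prime p" and ab: "a \<noteq> 0" "b \<noteq> 0"
  shows "rat_val p (of_int a / of_int b) =
    ereal (real (multiplicity (int p) a) - real (multiplicity (int p) b))"
proof -
  obtain n d where nd: "quotient_of (of_int a / of_int b) = (n, d)"
    by (cases "quotient_of (of_int a / of_int b)")
  have d: "d > 0" using nd by (rule quotient_of_denom_pos)
  have eq: "of_int a / of_int b = (of_int n / of_int d :: rat)"
    using nd by (rule quotient_of_div)
  have n: "n \<noteq> 0" using eq ab by auto
  have "of_int (a * d) = (of_int (n * b) :: rat)"
    using eq ab d by (simp add: field_simps)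
  hence "a * d = n * b" using of_int_eq_iff by blast
  moreover have "prime_elem (int p)" using p by auto
  ultimately have "multiplicity (int p) a + multiplicity (int p) d =
      multiplicity (int p) n + multiplicity (int p) b"
    using ab n d by (metis less_irrefl prime_elem_multiplicity_mult_distrib)
  hence "real (multiplicity (int p) a) + real (multiplicity (int p) d) =
      real (multiplicity (int p) n) + real (multiplicity (int p) b)"
    by (metis of_nat_add)
  thus ?thesis using ab nd by (simp add: rat_val_def)
qed

lemma rat_val_minus [simp]: "rat_val p (- x) = rat_val p x"
proof -
  have "multiplicity (int p) (- n) = multiplicity (int p) n" for n
    by (metis multiplicity_normalize_right normalize_int_def abs_minus_cancel)
  thus ?thesis by (cases "quotient_of x") (simp add: rat_val_def rat_uminus_code)
qed

lemma rat_val_diff_commute: "rat_val p (x - y) = rat_val p (y - x)"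
  by (metis minus_diff_eq rat_val_minus)

lemma rat_val_mult:
  assumes p: "prime p"
  shows "rat_val p (x * y) = rat_val p x + rat_val p y"
proof (cases "x = 0 \<or> y = 0")
  case False
  obtain a b where x: "x = of_int a / of_int b" and b: "b \<noteq> 0"
    by (metis Rat_cases Fract_of_int_quotient less_irrefl)
  obtain c d where y: "y = of_int c / of_int d" and d: "d \<noteq> 0"
    by (metis Rat_cases Fract_of_int_quotient less_irrefl)
  have ac: "a \<noteq> 0" "c \<noteq> 0" using False x y by auto
  have pe: "prime_elem (int p)" using p by auto
  have xy: "x * y = of_int (a * c) / of_int (b * d)" using x y by simp
  show ?thesis unfolding xy using x y b d ac
    by (simp add: rat_val_divide_of_int[OF p] prime_elem_multiplicity_mult_distrib[OF pe]
        del: of_int_mult)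
qed auto

lemma rat_val_add:
  assumes p: "prime p"
  shows "min (rat_val p x) (rat_val p y) \<le> rat_val p (x + y)"
proof (cases "x = 0 \<or> y = 0 \<or> x + y = 0")
  case False
  obtain a b where x: "x = of_int a / of_int b" and b: "b \<noteq> 0"
    by (metis Rat_cases Fract_of_int_quotient less_irrefl)
  obtain c d where y: "y = of_int c / of_int d" and d: "d \<noteq> 0"
    by (metis Rat_cases Fract_of_int_quotient less_irrefl)
  have nz: "a \<noteq> 0" "c \<noteq> 0" "b * d \<noteq> 0" using False x y b d by auto
  have xy: "x = of_int (a * d) / of_int (b * d)" "y = of_int (c * b) / of_int (b * d)"
    "x + y = of_int (a * d + c * b) / of_int (b * d)"
    using x y b d by (simp_all add: field_simps)
  have s: "a * d + c * b \<noteq> 0" using xy(3) False by (metis div_0 of_int_0)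
  let ?m = "multiplicity (int p)"
  have "\<not> is_unit (int p)" using p by auto
  moreover have "int p ^ min (?m (a * d)) (?m (c * b)) dvd a * d + c * b"
    by (intro dvd_add multiplicity_dvd') auto
  ultimately have "min (?m (a * d)) (?m (c * b)) \<le> ?m (a * d + c * b)"
    using s by (intro multiplicity_geI) auto
  hence "min (real (?m (a * d))) (real (?m (c * b))) \<le> real (?m (a * d + c * b))"
    by linarith
  moreover have "rat_val p x = ereal (real (?m (a * d)) - real (?m (b * d)))"
    unfolding xy(1) by (rule rat_val_divide_of_int[OF p]) (use nz d in auto)
  moreover have "rat_val p y = ereal (real (?m (c * b)) - real (?m (b * d)))"
    unfolding xy(2) by (rule rat_val_divide_of_int[OF p]) (use nz b in auto)
  moreover have "rat_val p (x + y) = ereal (real (?m (a * d + c * b)) - real (?m (b * d)))"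
    unfolding xy(3) by (rule rat_val_divide_of_int[OF p s nz(3)])
  moreover have "min (ereal u) (ereal v) = ereal (min u v)" for u v by (simp add: min_def)
  ultimately show ?thesis by (simp only: ereal_less_eq)
qed (auto simp: min_def)

lemma rat_val_add_ge:
  assumes "prime p" "k \<le> rat_val p x" "k \<le> rat_val p y"
  shows "k \<le> rat_val p (x + y)"
  using rat_val_add[OF assms(1), of x y] assms(2,3) by (auto simp: min_def split: if_splits)

lemma rat_val_add_eq:
  assumes p: "prime p" and lt: "rat_val p x < rat_val p y"
  shows "rat_val p (x + y) = rat_val p x"
proof -
  have "rat_val p x \<le> rat_val p (x + y)" using rat_val_add_ge[OF p] lt by simp
  moreover have "min (rat_val p (x + y)) (rat_val p y) \<le> rat_val p x"
    using rat_val_add[OF p, of "x + y" "- y"] by simp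
  ultimately show ?thesis using lt by (auto simp: min_def split: if_splits)
qed

lemma rat_val_inverse:
  assumes p: "prime p" and x: "x \<noteq> 0"
  shows "rat_val p (inverse x) = - rat_val p x"
proof -
  have "rat_val p x + rat_val p (inverse x) = 0"
    using rat_val_mult[OF p, of x "inverse x"] x by simp
  moreover have "\<bar>rat_val p x\<bar> \<noteq> \<infinity>" "\<bar>rat_val p (inverse x)\<bar> \<noteq> \<infinity>"
    using x by auto
  ultimately show ?thesis
    by (cases "rat_val p x"; cases "rat_val p (inverse x)") auto
qed


section \<open>Cauchy sequences and null sequences for the $p$-adic valuation\<close>

definition padic_Cauchy :: "nat \<Rightarrow> (nat \<Rightarrow> rat) \<Rightarrow> bool" where
  "padic_Cauchy p X \<longleftrightarrow>
    (\<forall>k::real. \<exists>N. \<forall>m\<ge>N. \<forall>n\<ge>N. ereal k \<le> rat_val p (X m - X n))"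

definition padic_null :: "nat \<Rightarrow> (nat \<Rightarrow> rat) \<Rightarrow> bool" where
  "padic_null p X \<longleftrightarrow> (\<forall>k::real. \<exists>N. \<forall>n\<ge>N. ereal k \<le> rat_val p (X n))"

lemma padic_Cauchy_const [simp]: "padic_Cauchy p (\<lambda>n. x)"
  by (simp add: padic_Cauchy_def)

lemma padic_null_const_iff [simp]: "padic_null p (\<lambda>n. x) \<longleftrightarrow> x = 0"
proof
  assume "padic_null p (\<lambda>n. x)"
  hence "\<forall>k::real. ereal k \<le> rat_val p x" by (auto simp: padic_null_def)
  hence "rat_val p x = \<infinity>" by (meson ereal_top)
  thus "x = 0" by simp
qed (simp add: padic_null_def)

lemma padic_null_add:
  assumes p: "prime p" and "padic_null p X" "padic_null p Y"
  shows "padic_null p (\<lambda>n. X n + Y n)"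
  unfolding padic_null_def
proof
  fix k :: real
  obtain N M where "\<forall>n\<ge>N. ereal k \<le> rat_val p (X n)" "\<forall>n\<ge>M. ereal k \<le> rat_val p (Y n)"
    using assms unfolding padic_null_def by meson
  thus "\<exists>N. \<forall>n\<ge>N. ereal k \<le> rat_val p (X n + Y n)"
    by (intro exI[of _ "max N M"]) (auto intro: rat_val_add_ge[OF p])
qed

lemma padic_null_minus [simp]: "padic_null p (\<lambda>n. - X n) \<longleftrightarrow> padic_null p X"
  by (simp add: padic_null_def)

lemma padic_null_diff:
  assumes "prime p" "padic_null p X" "padic_null p Y"
  shows "padic_null p (\<lambda>n. X n - Y n)"
  using padic_null_add[of p X "\<lambda>n. - Y n"] assms by simp

lemma padic_Cauchy_add:
  assumes p: "prime p" and "padic_Cauchy p X" "padic_Cauchy p Y"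
  shows "padic_Cauchy p (\<lambda>n. X n + Y n)"
  unfolding padic_Cauchy_def
proof
  fix k :: real
  obtain N M where NM: "\<forall>m\<ge>N. \<forall>n\<ge>N. ereal k \<le> rat_val p (X m - X n)"
    "\<forall>m\<ge>M. \<forall>n\<ge>M. ereal k \<le> rat_val p (Y m - Y n)"
    using assms unfolding padic_Cauchy_def by meson
  show "\<exists>N. \<forall>m\<ge>N. \<forall>n\<ge>N. ereal k \<le> rat_val p (X m + Y m - (X n + Y n))"
    using NM by (intro exI[of _ "max N M"]) (auto simp: add_diff_add intro: rat_val_add_ge[OF p])
qed

lemma padic_Cauchy_minus [simp]: "padic_Cauchy p (\<lambda>n. - X n) \<longleftrightarrow> padic_Cauchy p X"
proof -
  have "rat_val p (- X m - - X n) = rat_val p (X m - X n)" for m n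
    unfolding minus_diff_minus by (rule rat_val_minus)
  thus ?thesis by (simp only: padic_Cauchy_def)
qed

lemma padic_Cauchy_bounded:
  assumes p: "prime p" and X: "padic_Cauchy p X"
  shows "\<exists>b::real. \<forall>n. ereal b \<le> rat_val p (X n)"
proof -
  obtain N where N: "\<forall>m\<ge>N. \<forall>n\<ge>N. ereal 0 \<le> rat_val p (X m - X n)"
    using X unfolding padic_Cauchy_def by meson
  define B where "B = Min (insert 0 (rat_val p ` X ` {..N}))"
  have "B \<in> insert 0 (rat_val p ` X ` {..N})" unfolding B_def by (rule Min_in) auto
  then consider "B = 0" | n where "B = rat_val p (X n)" by blast
  hence "B \<noteq> -\<infinity>" by cases simp_all
  moreover have B0: "B \<le> 0" unfolding B_def by (rule Min_le) auto
  ultimately obtain b where b: "B = ereal b" by (cases B) auto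
  have le: "B \<le> rat_val p (X n)" if "n \<le> N" for n
    unfolding B_def by (rule Min_le) (use that in auto)
  have "B \<le> rat_val p (X n)" for n
  proof (cases "n \<le> N")
    case False
    hence "ereal 0 \<le> rat_val p (X n - X N)" using N by simp
    hence "0 \<le> rat_val p (X n - X N)" by (simp add: zero_ereal_def)
    with B0 have "B \<le> rat_val p (X n - X N)" by (rule order_trans)
    hence "B \<le> rat_val p (X N + (X n - X N))" by (intro rat_val_add_ge[OF p] le) auto
    thus ?thesis by simp
  qed (rule le)
  thus ?thesis using b by auto
qed

lemma padic_null_mult_bounded:
  assumes p: "prime p" and X: "padic_Cauchy p X" and Y: "padic_null p Y"
  shows "padic_null p (\<lambda>n. X n * Y n)"
  unfolding padic_null_def
proof
  fix k :: real
  obtain b :: real where b: "\<forall>n. ereal b \<le> rat_val p (X n)"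
    using padic_Cauchy_bounded[OF p X] by auto
  obtain N where N: "\<forall>n\<ge>N. ereal (k - b) \<le> rat_val p (Y n)"
    using Y unfolding padic_null_def by meson
  have "ereal b + ereal (k - b) \<le> rat_val p (X n * Y n)" if "n \<ge> N" for n
    unfolding rat_val_mult[OF p] using b N that by (intro add_mono) auto
  thus "\<exists>N. \<forall>n\<ge>N. ereal k \<le> rat_val p (X n * Y n)" by auto
qed

lemma padic_Cauchy_mult:
  assumes p: "prime p" and X: "padic_Cauchy p X" and Y: "padic_Cauchy p Y"
  shows "padic_Cauchy p (\<lambda>n. X n * Y n)"
  unfolding padic_Cauchy_def
proof
  fix k :: real
  obtain a b :: real where
    ab: "\<forall>n. ereal a \<le> rat_val p (X n)" "\<forall>n. ereal b \<le> rat_val p (Y n)"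
    using padic_Cauchy_bounded[OF p X] padic_Cauchy_bounded[OF p Y] by auto
  obtain N M where NM: "\<forall>m\<ge>N. \<forall>n\<ge>N. ereal (k - b) \<le> rat_val p (X m - X n)"
    "\<forall>m\<ge>M. \<forall>n\<ge>M. ereal (k - a) \<le> rat_val p (Y m - Y n)"
    using X Y unfolding padic_Cauchy_def by meson
  have "ereal k \<le> rat_val p (X m * Y m - X n * Y n)" if "m \<ge> max N M" "n \<ge> max N M" for m n
  proof -
    have "ereal a + ereal (k - a) \<le> rat_val p (X m * (Y m - Y n))"
      unfolding rat_val_mult[OF p] using ab NM that by (intro add_mono) auto
    moreover have "ereal (k - b) + ereal b \<le> rat_val p ((X m - X n) * Y n)"
      unfolding rat_val_mult[OF p] using ab NM that by (intro add_mono) auto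
    ultimately show ?thesis unfolding mult_diff_mult by (intro rat_val_add_ge[OF p]) auto
  qed
  thus "\<exists>N. \<forall>m\<ge>N. \<forall>n\<ge>N. ereal k \<le> rat_val p (X m * Y m - X n * Y n)" by blast
qed

lemma padic_Cauchy_not_null:
  assumes p: "prime p" and X: "padic_Cauchy p X" and nn: "\<not> padic_null p X"
  shows "\<exists>c::real. \<exists>N. \<forall>n\<ge>N. rat_val p (X n) = ereal c"
proof -
  obtain k :: real where k: "\<forall>N. \<exists>n\<ge>N. rat_val p (X n) < ereal k"
    using nn unfolding padic_null_def by (auto simp: not_le)
  obtain N where N: "\<forall>m\<ge>N. \<forall>n\<ge>N. ereal k \<le> rat_val p (X m - X n)"
    using X unfolding padic_Cauchy_def by meson
  obtain l where l: "l \<ge> N" "rat_val p (X l) < ereal k" using k by blast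
  have "rat_val p (X n) = rat_val p (X l)" if "n \<ge> N" for n
  proof -
    have "rat_val p (X l) < rat_val p (X n - X l)" using N l that by (meson less_le_trans)
    thus ?thesis using rat_val_add_eq[OF p, of "X l" "X n - X l"] by simp
  qed
  moreover obtain c where "rat_val p (X l) = ereal c" using l by (cases "rat_val p (X l)") auto
  ultimately show ?thesis by metis
qed

lemma padic_diff_inverse_ge:
  assumes p: "prime p" and x: "rat_val p x = ereal c" and y: "rat_val p y = ereal d"
    and k: "ereal (k + c + d) \<le> rat_val p (x - y)"
  shows "ereal k \<le> rat_val p (inverse x - inverse y)"
proof -
  have nz: "x \<noteq> 0" "y \<noteq> 0" using x y by auto
  have "inverse x - inverse y = - (inverse x * (x - y) * inverse y)"
    using nz by (simp add: inverse_diff_inverse)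
  hence "rat_val p (inverse x - inverse y) = ereal (- c) + rat_val p (x - y) + ereal (- d)"
    using nz x y by (simp add: rat_val_mult[OF p] rat_val_inverse[OF p])
  thus ?thesis using k by (cases "rat_val p (x - y)") auto
qed

lemma padic_Cauchy_inverse:
  assumes p: "prime p" and X: "padic_Cauchy p X" and nn: "\<not> padic_null p X"
  shows "padic_Cauchy p (\<lambda>n. inverse (X n))"
  unfolding padic_Cauchy_def
proof
  fix k :: real
  obtain c N where c: "\<forall>n\<ge>N. rat_val p (X n) = ereal c"
    using padic_Cauchy_not_null[OF assms] by auto
  obtain M where M: "\<forall>m\<ge>M. \<forall>n\<ge>M. ereal (k + c + c) \<le> rat_val p (X m - X n)"
    using X unfolding padic_Cauchy_def by meson
  have "ereal k \<le> rat_val p (inverse (X m) - inverse (X n))"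
    if "m \<ge> max N M" "n \<ge> max N M" for m n
    using c M that by (intro padic_diff_inverse_ge[OF p, where c = c and d = c]) simp_all
  thus "\<exists>N. \<forall>m\<ge>N. \<forall>n\<ge>N. ereal k \<le> rat_val p (inverse (X m) - inverse (X n))"
    by blast
qed

lemma padic_null_diff_inverse:
  assumes p: "prime p" and X: "padic_Cauchy p X" "\<not> padic_null p X"
    and Y: "padic_Cauchy p Y" "\<not> padic_null p Y"
    and XY: "padic_null p (\<lambda>n. X n - Y n)"
  shows "padic_null p (\<lambda>n. inverse (X n) - inverse (Y n))"
  unfolding padic_null_def
proof
  fix k :: real
  obtain c N where c: "\<forall>n\<ge>N. rat_val p (X n) = ereal c"
    using padic_Cauchy_not_null[OF p X] by auto
  obtain d M where d: "\<forall>n\<ge>M. rat_val p (Y n) = ereal d"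
    using padic_Cauchy_not_null[OF p Y] by auto
  obtain L where L: "\<forall>n\<ge>L. ereal (k + c + d) \<le> rat_val p (X n - Y n)"
    using XY unfolding padic_null_def by meson
  have "ereal k \<le> rat_val p (inverse (X n) - inverse (Y n))"
    if "n \<ge> max L (max N M)" for n
    using c d L that by (intro padic_diff_inverse_ge[OF p, where c = c and d = d]) simp_all
  thus "\<exists>N. \<forall>n\<ge>N. ereal k \<le> rat_val p (inverse (X n) - inverse (Y n))"
    by blast
qed

lemma padic_Cauchy_val_lim:
  assumes p: "prime p" and X: "padic_Cauchy p X"
  shows "padic_null p X \<Longrightarrow> (\<lambda>n. rat_val p (X n)) \<longlonglongrightarrow> \<infinity>"
    and "\<not> padic_null p X \<Longrightarrow> \<exists>c. (\<forall>\<^sub>F n in sequentially. rat_val p (X n) = ereal c)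
        \<and> (\<lambda>n. rat_val p (X n)) \<longlonglongrightarrow> ereal c"
proof -
  show "(\<lambda>n. rat_val p (X n)) \<longlonglongrightarrow> \<infinity>" if "padic_null p X"
    unfolding tendsto_PInfty eventually_sequentially
  proof
    fix r :: real
    obtain N where "\<forall>n\<ge>N. ereal (r + 1) \<le> rat_val p (X n)"
      using \<open>padic_null p X\<close> unfolding padic_null_def by meson
    moreover have "ereal r < ereal (r + 1)" by simp
    ultimately show "\<exists>N. \<forall>n\<ge>N. ereal r < rat_val p (X n)" by (meson less_le_trans)
  qed
  show "\<exists>c. (\<forall>\<^sub>F n in sequentially. rat_val p (X n) = ereal c)
        \<and> (\<lambda>n. rat_val p (X n)) \<longlonglongrightarrow> ereal c" if nn: "\<not> padic_null p X"
  proof -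
    obtain c N where "\<forall>n\<ge>N. rat_val p (X n) = ereal c"
      using padic_Cauchy_not_null[OF p X nn] by auto
    hence "\<forall>\<^sub>F n in sequentially. rat_val p (X n) = ereal c"
      by (auto simp: eventually_sequentially)
    with tendsto_eventually[OF this] show ?thesis by (intro exI[of _ c] conjI)
  qed
qed

lemma padic_Cauchy_val_LIMSEQ:
  assumes "prime p" "padic_Cauchy p X"
  shows "(\<lambda>n. rat_val p (X n)) \<longlonglongrightarrow> lim (\<lambda>n. rat_val p (X n))"
proof (cases "padic_null p X")
  case True
  thus ?thesis using padic_Cauchy_val_lim(1)[OF assms] limI by fastforce
next
  case False
  thus ?thesis using padic_Cauchy_val_lim(2)[OF assms] limI by fastforce
qed


section \<open>The field of $p$-adic numbers\<close>

text \<open>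
  The type \<open>'p padic\<close> is the completion of the rationals with respect to the $p$-adic
  valuation, where the prime $p$ is \<open>CARD('p)\<close>. It consists of the classes of Cauchy sequences
  modulo null sequences.
\<close>

definition padic_rel :: "nat \<Rightarrow> (nat \<Rightarrow> rat) \<Rightarrow> (nat \<Rightarrow> rat) \<Rightarrow> bool" where
  "padic_rel p X Y \<longleftrightarrow>
    padic_Cauchy p X \<and> padic_Cauchy p Y \<and> padic_null p (\<lambda>n. X n - Y n)"

lemma padic_rel_refl: "padic_rel p X X \<longleftrightarrow> padic_Cauchy p X"
  by (simp add: padic_rel_def)

lemma padic_rel_sym: "padic_rel p X Y \<Longrightarrow> padic_rel p Y X"
  by (auto simp: padic_rel_def padic_null_def rat_val_diff_commute)

lemma part_equivp_padic_rel:
  assumes "prime p"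
  shows "part_equivp (padic_rel p)"
proof (rule part_equivpI)
  show "\<exists>X. padic_rel p X X"
    by (rule exI[of _ "\<lambda>_. 0"]) (simp add: padic_rel_refl)
  show "symp (padic_rel p)" by (rule sympI) (rule padic_rel_sym)
  show "transp (padic_rel p)"
  proof (rule transpI)
    fix X Y Z assume *: "padic_rel p X Y" "padic_rel p Y Z"
    hence "padic_null p (\<lambda>n. (X n - Y n) + (Y n - Z n))"
      unfolding padic_rel_def by (intro padic_null_add[OF assms]) simp_all
    thus "padic_rel p X Z" using * by (simp add: padic_rel_def)
  qed
qed

typedef (overloaded) 'p padic =
    "{c. \<exists>X. padic_rel CARD('p::prime_card) X X \<and> c = Collect (padic_rel CARD('p) X)}"
  morphisms padic_class padic_of_class
  by (rule part_equivp_typedef[OF part_equivp_padic_rel[OF prime_card]])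

definition abs_padic :: "(nat \<Rightarrow> rat) \<Rightarrow> 'p::prime_card padic" where
  "abs_padic = quot_type.abs (padic_rel CARD('p)) padic_of_class"

definition rep_padic :: "'p::prime_card padic \<Rightarrow> (nat \<Rightarrow> rat)" where
  "rep_padic = quot_type.rep padic_class"

definition cr_padic :: "(nat \<Rightarrow> rat) \<Rightarrow> 'p::prime_card padic \<Rightarrow> bool" where
  "cr_padic = (\<lambda>X x. padic_rel CARD('p) X X \<and> abs_padic X = x)"

lemma Quotient_padic:
  "Quotient (padic_rel CARD('p::prime_card)) abs_padic rep_padic
    (cr_padic :: _ \<Rightarrow> 'p padic \<Rightarrow> bool)"
proof -
  interpret quot_type "padic_rel CARD('p)" "padic_of_class :: _ \<Rightarrow> 'p padic" padic_class
  proof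
    show "part_equivp (padic_rel CARD('p))" by (rule part_equivp_padic_rel[OF prime_card])
    show "\<exists>X. padic_rel CARD('p) X X \<and> padic_class x = Collect (padic_rel CARD('p) X)"
      for x :: "'p padic"
      using padic_class[of x] by simp
    show "padic_of_class (padic_class x) = x" for x :: "'p padic"
      by (rule padic_class_inverse)
    show "padic_class (padic_of_class c :: 'p padic) = c"
      if "\<exists>X. padic_rel CARD('p) X X \<and> c = Collect (padic_rel CARD('p) X)" for c
      using that by (intro padic_of_class_inverse) simp
    show "padic_class x = padic_class y \<longleftrightarrow> x = y" for x y :: "'p padic"
      by (rule padic_class_inject)
  qed
  show ?thesis
    using Quotient unfolding abs_padic_def[symmetric] rep_padic_def[symmetric]
    by (rule Quotient3_to_Quotient) (simp add: cr_padic_def)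
qed

setup_lifting Quotient_padic

instantiation padic :: (prime_card) field
begin

lift_definition zero_padic :: "'a padic" is "\<lambda>n. 0"
  by (simp add: padic_rel_refl)

lift_definition one_padic :: "'a padic" is "\<lambda>n. 1"
  by (simp add: padic_rel_refl)

lift_definition plus_padic :: "'a padic \<Rightarrow> 'a padic \<Rightarrow> 'a padic" is "\<lambda>X Y n. X n + Y n"
  unfolding padic_rel_def add_diff_add
  by (simp add: padic_Cauchy_add padic_null_add prime_card)

lift_definition uminus_padic :: "'a padic \<Rightarrow> 'a padic" is "\<lambda>X n. - X n"
  unfolding padic_rel_def minus_diff_minus padic_null_minus padic_Cauchy_minus .

lift_definition times_padic :: "'a padic \<Rightarrow> 'a padic \<Rightarrow> 'a padic" is "\<lambda>X Y n. X n * Y n"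
proof -
  fix X Y Z W
  let ?p = "CARD('a)"
  assume XY: "padic_rel ?p X Y" and ZW: "padic_rel ?p Z W"
  have "padic_null ?p (\<lambda>n. X n * (Z n - W n) + W n * (X n - Y n))"
    using XY ZW unfolding padic_rel_def
    by (intro padic_null_add padic_null_mult_bounded prime_card) auto
  also have "(\<lambda>n. X n * (Z n - W n) + W n * (X n - Y n)) = (\<lambda>n. X n * Z n - Y n * W n)"
    by (simp add: algebra_simps)
  finally show "padic_rel ?p (\<lambda>n. X n * Z n) (\<lambda>n. Y n * W n)"
    using XY ZW by (simp add: padic_rel_def padic_Cauchy_mult prime_card)
qed

lift_definition inverse_padic :: "'a padic \<Rightarrow> 'a padic"
  is "\<lambda>X. if padic_null CARD('a) X then (\<lambda>n. 0) else (\<lambda>n. inverse (X n))"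
proof -
  fix X Y
  let ?p = "CARD('a)"
  assume XY: "padic_rel ?p X Y"
  have "padic_null ?p X \<longleftrightarrow> padic_null ?p Y"
    using XY padic_null_diff[of ?p X "\<lambda>n. X n - Y n"] padic_null_add[of ?p "\<lambda>n. X n - Y n" Y]
    by (auto simp: padic_rel_def prime_card)
  thus "padic_rel ?p (if padic_null ?p X then (\<lambda>n. 0) else (\<lambda>n. inverse (X n)))
      (if padic_null ?p Y then (\<lambda>n. 0) else (\<lambda>n. inverse (Y n)))"
    using XY by (auto simp: padic_rel_def padic_Cauchy_inverse padic_null_diff_inverse prime_card)
qed

definition minus_padic :: "'a padic \<Rightarrow> 'a padic \<Rightarrow> 'a padic" where
  "x - y = x + - y" for x y :: "'a padic"

definition divide_padic :: "'a padic \<Rightarrow> 'a padic \<Rightarrow> 'a padic" where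
  "x div y = x * inverse y" for x y :: "'a padic"

instance
proof
  fix a b c :: "'a padic"
  note [simp] = padic_Cauchy_add padic_Cauchy_mult prime_card
  show "a + b + c = a + (b + c)"
    by transfer (simp add: padic_rel_def ac_simps)
  show "a + b = b + a"
    by transfer (simp add: padic_rel_def ac_simps)
  show "0 + a = a"
    by transfer (simp add: padic_rel_def)
  show "- a + a = 0"
    by transfer (simp add: padic_rel_def)
  show "a - b = a + - b"
    by (rule minus_padic_def)
  show "a * b * c = a * (b * c)"
    by transfer (simp add: padic_rel_def ac_simps)
  show "a * b = b * a"
    by transfer (simp add: padic_rel_def ac_simps)
  show "1 * a = a"
    by transfer (simp add: padic_rel_def)
  show "(a + b) * c = a * c + b * c"
    by transfer (simp add: padic_rel_def distrib_right)
  show "(0 :: 'a padic) \<noteq> 1"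
    by transfer (simp add: padic_rel_def)
  show "inverse (0 :: 'a padic) = 0"
    by transfer (simp add: padic_rel_def)
  show "a div b = a * inverse b"
    by (rule divide_padic_def)
  have "padic_null CARD('a) (\<lambda>n. inverse (X n) * X n - 1)"
    if X: "padic_Cauchy CARD('a) X" "\<not> padic_null CARD('a) X" for X
  proof -
    obtain c N where "\<forall>n\<ge>N. rat_val CARD('a) (X n) = ereal c"
      using padic_Cauchy_not_null[OF prime_card X] by auto
    hence "\<forall>n\<ge>N. X n \<noteq> 0" by (metis PInfty_neq_ereal(1) rat_val_0)
    hence "\<forall>n\<ge>N. ereal k \<le> rat_val CARD('a) (inverse (X n) * X n - 1)" for k
      by simp
    thus ?thesis unfolding padic_null_def by blast
  qed
  thus "a \<noteq> 0 \<Longrightarrow> inverse a * a = 1"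
    by transfer (auto simp: padic_rel_def padic_Cauchy_inverse)
qed

end


section \<open>Valuation and topology\<close>

text \<open>
  The valuation is the continuous extension of the valuation on the rationals; along a Cauchy
  sequence, the latter is eventually constant or tends to infinity.
\<close>

lift_definition padic_val :: "'p::prime_card padic \<Rightarrow> ereal"
  is "\<lambda>X. lim (\<lambda>n. rat_val CARD('p) (X n))"
proof -
  fix X Y
  let ?p = "CARD('p)"
  assume XY: "padic_rel ?p X Y"
  hence X: "padic_Cauchy ?p X" and Y: "padic_Cauchy ?p Y" by (auto simp: padic_rel_def)
  show "lim (\<lambda>n. rat_val ?p (X n)) = lim (\<lambda>n. rat_val ?p (Y n))"
  proof (cases "padic_null ?p X")
    case True
    moreover from this have "padic_null ?p Y"
      using XY padic_null_diff[of ?p X "\<lambda>n. X n - Y n"] by (auto simp: padic_rel_def prime_card)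
    ultimately show ?thesis
      using padic_Cauchy_val_lim(1)[OF prime_card X] padic_Cauchy_val_lim(1)[OF prime_card Y]
      by (metis limI)
  next
    case False
    then obtain c where c: "\<forall>\<^sub>F n in sequentially. rat_val ?p (X n) = ereal c"
      "(\<lambda>n. rat_val ?p (X n)) \<longlonglongrightarrow> ereal c"
      using padic_Cauchy_val_lim(2)[OF prime_card X] by blast
    have "\<forall>\<^sub>F n in sequentially. ereal (c + 1) \<le> rat_val ?p (Y n - X n)"
      using padic_rel_sym[OF XY] unfolding padic_rel_def padic_null_def eventually_sequentially
      by blast
    with c(1) have "\<forall>\<^sub>F n in sequentially. rat_val ?p (Y n) = ereal c"
    proof eventually_elim
      case (elim n)
      have "ereal c < ereal (c + 1)" by simp
      also note elim(2)
      finally have "rat_val ?p (X n) < rat_val ?p (Y n - X n)" using elim(1) by simp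
      hence "rat_val ?p (X n + (Y n - X n)) = rat_val ?p (X n)"
        by (rule rat_val_add_eq[OF prime_card])
      thus ?case using elim(1) by simp
    qed
    hence "(\<lambda>n. rat_val ?p (Y n)) \<longlonglongrightarrow> ereal c" by (rule tendsto_eventually)
    thus ?thesis using c(2) by (metis limI)
  qed
qed

lemma padic_val_eq_PInf_iff [simp]: "padic_val x = \<infinity> \<longleftrightarrow> x = 0"
proof (transfer, unfold padic_rel_refl)
  fix X :: "nat \<Rightarrow> rat"
  let ?p = "CARD('a)"
  assume X: "padic_Cauchy ?p X"
  have p: "prime ?p" by (rule prime_card)
  have "lim (\<lambda>n. rat_val ?p (X n)) = \<infinity> \<longleftrightarrow> padic_null ?p X"
    using padic_Cauchy_val_lim[OF p X] by (metis PInfty_neq_ereal(1) limI)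
  thus "lim (\<lambda>n. rat_val ?p (X n)) = \<infinity> \<longleftrightarrow> padic_rel ?p X (\<lambda>n. 0)"
    using X by (simp add: padic_rel_def)
qed

lemma padic_val_0 [simp]: "padic_val 0 = \<infinity>"
  by simp

lemma lim_rat_val_not_MInf:
  assumes "prime p" "padic_Cauchy p X"
  shows "lim (\<lambda>n. rat_val p (X n)) \<noteq> -\<infinity>"
proof (cases "padic_null p X")
  case True
  thus ?thesis using limI[OF padic_Cauchy_val_lim(1)[OF assms]] by simp
next
  case False
  thus ?thesis using padic_Cauchy_val_lim(2)[OF assms] by (auto dest: limI)
qed

lemma padic_val_not_MInf [simp]: "padic_val x \<noteq> -\<infinity>"
  by transfer (rule lim_rat_val_not_MInf[OF prime_card], simp add: padic_rel_refl)

lemma padic_val_minus [simp]: "padic_val (- x) = padic_val x"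
  by transfer simp

lemma padic_val_mult: "padic_val (x * y) = padic_val x + padic_val y"
proof (transfer, unfold padic_rel_refl)
  fix X Y :: "nat \<Rightarrow> rat"
  let ?p = "CARD('a)"
  assume X: "padic_Cauchy ?p X" and Y: "padic_Cauchy ?p Y"
  note lim = padic_Cauchy_val_LIMSEQ[OF prime_card X] padic_Cauchy_val_LIMSEQ[OF prime_card Y]
  note nm = lim_rat_val_not_MInf[OF prime_card X] lim_rat_val_not_MInf[OF prime_card Y]
  have "(\<lambda>n. rat_val ?p (X n) + rat_val ?p (Y n)) \<longlonglongrightarrow>
      lim (\<lambda>n. rat_val ?p (X n)) + lim (\<lambda>n. rat_val ?p (Y n))"
    using nm lim by (intro tendsto_add_ereal_general) auto
  thus "lim (\<lambda>n. rat_val ?p (X n * Y n)) =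
      lim (\<lambda>n. rat_val ?p (X n)) + lim (\<lambda>n. rat_val ?p (Y n))"
    by (simp add: rat_val_mult prime_card limI)
qed

lemma padic_val_add: "min (padic_val x) (padic_val y) \<le> padic_val (x + y)"
proof (transfer, unfold padic_rel_refl)
  fix X Y :: "nat \<Rightarrow> rat"
  let ?p = "CARD('a)"
  assume X: "padic_Cauchy ?p X" and Y: "padic_Cauchy ?p Y"
  have p: "prime ?p" by (rule prime_card)
  show "min (lim (\<lambda>n. rat_val ?p (X n))) (lim (\<lambda>n. rat_val ?p (Y n)))
      \<le> lim (\<lambda>n. rat_val ?p (X n + Y n))"
  proof (rule LIMSEQ_le)
    show "(\<lambda>n. min (rat_val ?p (X n)) (rat_val ?p (Y n))) \<longlonglongrightarrow>
        min (lim (\<lambda>n. rat_val ?p (X n))) (lim (\<lambda>n. rat_val ?p (Y n)))"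
      using X Y p by (intro tendsto_min padic_Cauchy_val_LIMSEQ)
    show "(\<lambda>n. rat_val ?p (X n + Y n)) \<longlonglongrightarrow> lim (\<lambda>n. rat_val ?p (X n + Y n))"
      using X Y p by (intro padic_Cauchy_val_LIMSEQ padic_Cauchy_add)
    show "\<exists>N. \<forall>n\<ge>N. min (rat_val ?p (X n)) (rat_val ?p (Y n)) \<le> rat_val ?p (X n + Y n)"
      using rat_val_add[OF p] by blast
  qed
qed

lemma padic_of_int: "(of_int k :: 'p::prime_card padic) = abs_padic (\<lambda>n. of_int k)"
proof -
  note rel = padic_rel_refl padic_Cauchy_const
  have nat: "(of_nat m :: 'p padic) = abs_padic (\<lambda>n. of_nat m)" for m
    by (induction m) (simp_all add: zero_padic_def one_padic_def plus_padic.abs_eq rel)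
  show ?thesis
  proof (cases k)
    case (nonneg m)
    thus ?thesis by (simp add: nat)
  next
    case (neg m)
    hence "(of_int k :: 'p padic) = - of_nat (Suc m)" by simp
    also have "\<dots> = abs_padic (\<lambda>n. - of_nat (Suc m))"
      unfolding nat by (simp add: uminus_padic.abs_eq rel del: of_nat_Suc)
    finally show ?thesis using neg by simp
  qed
qed

lemma padic_val_of_int:
  "padic_val (of_int k :: 'p::prime_card padic) =
    (if k = 0 then \<infinity> else ereal (real (multiplicity (int CARD('p)) k)))"
  by (simp add: padic_of_int padic_val.abs_eq padic_rel_refl rat_val_of_int)

instance padic :: (prime_card) field_char_0
proof
  have "of_int a \<noteq> (of_int b :: 'a padic)" if "a \<noteq> b" for a b
    using padic_val_of_int[of "a - b", where 'p = 'a] that by auto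
  thus "inj (of_nat :: nat \<Rightarrow> 'a padic)"
    by (intro injI) (metis of_int_of_nat_eq of_nat_eq_iff)
qed

instantiation padic :: (prime_card) metric_space
begin

definition dist_padic :: "'a padic \<Rightarrow> 'a padic \<Rightarrow> real" where
  "dist x y = (if x = y then 0 else real CARD('a) powr (- real_of_ereal (padic_val (x - y))))"
  for x y :: "'a padic"

definition uniformity_padic :: "('a padic \<times> 'a padic) filter" where
  "uniformity_padic = (INF e\<in>{0<..}. principal {(x, y). dist x y < e})"

definition open_padic :: "'a padic set \<Rightarrow> bool" where
  "open_padic U \<longleftrightarrow> (\<forall>x\<in>U. \<forall>\<^sub>F (x', y) in uniformity. x' = x \<longrightarrow> y \<in> U)"

instance
proof
  fix x y z :: "'a padic"
  show "(uniformity :: ('a padic \<times> 'a padic) filter) = (INF e\<in>{0<..}. principal {(x, y). dist x y < e})"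
    by (rule uniformity_padic_def)
  show "open U \<longleftrightarrow> (\<forall>x\<in>U. \<forall>\<^sub>F (x', y) in uniformity. x' = x \<longrightarrow> y \<in> U)" for U :: "'a padic set"
    by (rule open_padic_def)
  have "prime CARD('a)" by (rule prime_card)
  hence p: "real CARD('a) > 1" using prime_gt_1_nat by fastforce
  thus "dist x y = 0 \<longleftrightarrow> x = y" by (simp add: dist_padic_def)
  have comm: "padic_val (a - b) = padic_val (b - a)" for a b :: "'a padic"
    by (metis minus_diff_eq padic_val_minus)
  have "dist x y \<le> max (dist x z) (dist y z)"
  proof (cases "x = y \<or> x = z \<or> y = z")
    case True
    thus ?thesis using comm by (auto simp: dist_padic_def max_def)
  next
    case False
    have "padic_val (x - y) \<noteq> \<infinity>" "padic_val (x - z) \<noteq> \<infinity>" "padic_val (y - z) \<noteq> \<infinity>"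
      using False by simp_all
    then obtain a b c where v: "padic_val (x - y) = ereal a" "padic_val (x - z) = ereal b"
      "padic_val (y - z) = ereal c"
      by (metis ereal_cases padic_val_not_MInf)
    have "min (padic_val (x - z)) (padic_val (z - y)) \<le> padic_val (x - y)"
      using padic_val_add[of "x - z" "z - y"] by simp
    hence "min b c \<le> a" using v comm[of z y] by (simp add: min_def split: if_splits)
    thus ?thesis using False p v by (auto simp: dist_padic_def max_def min_def split: if_splits)
  qed
  also have "\<dots> \<le> dist x z + dist y z" by (simp add: dist_padic_def)
  finally show "dist x y \<le> dist x z + dist y z" .
qed

end

definition padic_ints :: "'p::prime_card padic set" where
  "padic_ints = {x. 0 \<le> padic_val x}"


section \<open>Locally analytic functions\<close>

text \<open>
  A function on the $p$-adic integers is represented by a total function on \<open>'p padic\<close> of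
  which only the values on \<^const>\<open>padic_ints\<close> matter.
\<close>

definition padic_locally_analytic :: "('p::prime_card padic \<Rightarrow> 'p padic) \<Rightarrow> bool" where
  "padic_locally_analytic f \<longleftrightarrow>
    (\<forall>x0\<in>padic_ints. \<exists>U a. open U \<and> x0 \<in> U \<and>
      (\<forall>x\<in>U \<inter> padic_ints. (\<lambda>n. a n * (x - x0) ^ n) sums f x))"


section \<open>Congruence classes and valuations\<close>

definition cong_class :: "int \<Rightarrow> nat \<Rightarrow> int set" where
  "cong_class a d = {n. [n = a] (mod int d)}"

definition val_set :: "('p::prime_card padic \<Rightarrow> 'p padic) \<Rightarrow> int set \<Rightarrow> ereal set" where
  "val_set f C = {padic_val (f (of_int n)) | n. n \<in> C \<and> n > 0}"

definition min_val :: "('p::prime_card padic \<Rightarrow> 'p padic) \<Rightarrow> int set \<Rightarrow> ereal" where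
  "min_val f C = (LEAST t. t \<in> val_set f C)"

text \<open>The valuation of a constant class may be infinite.\<close>

definition constant_class :: "('p::prime_card padic \<Rightarrow> 'p padic) \<Rightarrow> int set \<Rightarrow> ereal \<Rightarrow> bool" where
  "constant_class f C t \<longleftrightarrow> (\<forall>n\<in>C. n > 0 \<longrightarrow> padic_val (f (of_int n)) = t)"

definition nonconstant_class :: "('p::prime_card padic \<Rightarrow> 'p padic) \<Rightarrow> int set \<Rightarrow> bool" where
  "nonconstant_class f C \<longleftrightarrow> (\<nexists>t. constant_class f C t)"

definition nonconstant_classes :: "('p::prime_card padic \<Rightarrow> 'p padic) \<Rightarrow> nat \<Rightarrow> int set set" where
  "nonconstant_classes f d = {C. (\<exists>a. C = cong_class a d) \<and> nonconstant_class f C}"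

end

theory Submission
  imports Defs
begin

text \<open>
  Near a point \<open>x0\<close> the first nonzero term \<open>a k * (x - x0) ^ k\<close> of the power series dominates the
  others, so that \<open>f\<close> vanishes there or has valuation \<open>\<beta> + k * padic_val (x - x0)\<close>. By compactness,
  one level \<open>M\<close> serves all classes. A nonconstant class of level \<open>m \<ge> M\<close> must then be the set of
  integers at distance at most \<open>p\<close> to the \<open>-m\<close> from the corresponding \<open>x0\<close>; its minimal valuation
  \<open>\<beta> + k * m\<close> is attained exactly outside its subclass of level \<open>m + 1\<close> around \<open>x0\<close>.
\<close>

section \<open>Valuations\<close>

text \<open>Valuations live in \<open>ereal\<close>, so integrality has to be recovered: along a
  Cauchy sequence that is not null the rational valuation is eventually constant, so its limit is
  one of its values, a difference of two multiplicities.\<close>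

lemma padic_val_integral:
  fixes x :: "'p::prime_card padic"
  assumes "x \<noteq> 0"
  shows "\<exists>k::int. padic_val x = ereal (of_int k)"
  using assms
proof (transfer, unfold padic_rel_refl)
  fix X :: "nat \<Rightarrow> rat"
  let ?p = "CARD('p)"
  assume X: "padic_Cauchy ?p X" and "\<not> padic_rel ?p X (\<lambda>n. 0)"
  hence "\<not> padic_null ?p X" by (simp add: padic_rel_def)
  then obtain c where c: "\<forall>\<^sub>F n in sequentially. rat_val ?p (X n) = ereal c"
    "(\<lambda>n. rat_val ?p (X n)) \<longlonglongrightarrow> ereal c"
    using padic_Cauchy_val_lim(2)[OF prime_card X] by blast
  then obtain n where n: "rat_val ?p (X n) = ereal c" by (auto simp: eventually_sequentially)
  hence "c = of_int (int (multiplicity (int ?p) (fst (quotient_of (X n))))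
      - int (multiplicity (int ?p) (snd (quotient_of (X n)))))"
    by (auto simp: rat_val_def split: if_splits)
  with limI[OF c(2)] show "\<exists>k::int. lim (\<lambda>n. rat_val ?p (X n)) = ereal (of_int k)" by blast
qed

text \<open>Discreteness of the valuation. It makes the shell between the balls of levels
  \<open>m\<close> and \<open>Suc m\<close> consist of points at valuation exactly
  \<open>m\<close>.\<close>

lemma padic_val_Suc_leI:
  fixes x :: "'p::prime_card padic"
  assumes "ereal (real m) \<le> padic_val x" "padic_val x \<noteq> ereal (real m)"
  shows "ereal (real (Suc m)) \<le> padic_val x"
proof (cases "x = 0")
  case False
  then obtain k :: int where k: "padic_val x = ereal (of_int k)" using padic_val_integral by blast
  with assms have "int m \<le> k" "k \<noteq> int m" by auto
  hence "int (Suc m) \<le> k" by simp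
  hence "real_of_int (int (Suc m)) \<le> of_int k" by (simp only: of_int_le_iff)
  thus ?thesis using k by simp
qed simp

lemma padic_val_diff_commute: "padic_val (x - y) = padic_val (y - x)"
  by (metis minus_diff_eq padic_val_minus)

lemma padic_val_add_ge:
  assumes "k \<le> padic_val x" "k \<le> padic_val y"
  shows "k \<le> padic_val (x + y)"
  using padic_val_add[of x y] assms by (auto simp: min_def split: if_splits)

lemma padic_val_diff_ge:
  assumes "k \<le> padic_val x" "k \<le> padic_val y"
  shows "k \<le> padic_val (x - y)"
  using padic_val_add_ge[of k x "- y"] assms by simp

lemma padic_val_add_eq:
  assumes "padic_val x < padic_val y"
  shows "padic_val (x + y) = padic_val x"
proof -
  have "padic_val x \<le> padic_val (x + y)" using padic_val_add_ge[of "padic_val x" x y] assms by simp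
  moreover have "min (padic_val (x + y)) (padic_val y) \<le> padic_val x"
    using padic_val_add[of "x + y" "- y"] by simp
  ultimately show ?thesis using assms by (auto simp: min_def split: if_splits)
qed

lemma padic_val_sum_ge:
  assumes "\<And>i. i \<in> A \<Longrightarrow> k \<le> padic_val (g i)"
  shows "k \<le> padic_val (sum g A)"
  using assms by (induction A rule: infinite_finite_induct) (auto intro: padic_val_add_ge)

lemma padic_val_1 [simp]: "padic_val (1 :: 'p::prime_card padic) = 0"
  using padic_val_of_int[of 1, where 'p = 'p] by (simp add: zero_ereal_def)

lemma padic_val_power:
  assumes "padic_val x = ereal t"
  shows "padic_val (x ^ n) = ereal (real n * t)"
  by (induction n) (auto simp: padic_val_mult assms zero_ereal_def algebra_simps)

section \<open>Integers inside the p-adic integers, and their density\<close>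

lemma of_int_in_padic_ints [simp]: "of_int n \<in> padic_ints"
  by (simp add: padic_ints_def padic_val_of_int)

lemma padic_val_of_int_ge_iff:
  "ereal (real m) \<le> padic_val (of_int k :: 'p::prime_card padic) \<longleftrightarrow> int CARD('p) ^ m dvd k"
proof (cases "k = 0")
  case False
  have "\<not> is_unit (int CARD('p))" using prime_card[where 'a = 'p] by auto
  thus ?thesis using False by (simp add: padic_val_of_int power_dvd_iff_le_multiplicity)
qed simp

lemma cong_class_iff_padic_val:
  "n \<in> cong_class a (CARD('p) ^ m) \<longleftrightarrow>
    ereal (real m) \<le> padic_val (of_int n - of_int a :: 'p::prime_card padic)"
  using padic_val_of_int_ge_iff[of m "n - a", where 'p = 'p]
  by (simp add: cong_class_def cong_iff_dvd_diff)

text \<open>A bound that holds eventually for the rational terms survives in the limit. The point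
  \<open>y\<close> is tied to the constant sequence \<open>r\<close> by an equation because it is
  the class of a rational in one use and an \<open>of_int\<close> in another.\<close>

lemma abs_padic_val_diff_ge:
  fixes x :: "'p::prime_card padic"
  assumes X: "padic_Cauchy CARD('p) X"
    and ge: "\<forall>\<^sub>F n in sequentially. k \<le> rat_val CARD('p) (X n - r)"
    and r: "abs_padic (\<lambda>_. r) = y"
  shows "k \<le> padic_val (abs_padic X - y :: 'p padic)"
proof -
  let ?p = "CARD('p)"
  have C: "padic_Cauchy ?p (\<lambda>n. X n - r)"
    using padic_Cauchy_add[OF prime_card X, of "\<lambda>_. - r"] by simp
  have "abs_padic X - y = (abs_padic (\<lambda>n. X n - r) :: 'p padic)"
    using X by (simp add: minus_padic_def r[symmetric] uminus_padic.abs_eq plus_padic.abs_eq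
        padic_rel_refl)
  moreover have "padic_val (abs_padic (\<lambda>n. X n - r) :: 'p padic) = lim (\<lambda>n. rat_val ?p (X n - r))"
    using C by (simp add: padic_val.abs_eq padic_rel_refl)
  moreover have "k \<le> lim (\<lambda>n. rat_val ?p (X n - r))"
    using padic_Cauchy_val_LIMSEQ[OF prime_card C] ge
    by (intro tendsto_lowerbound[where F = sequentially]) auto
  ultimately show ?thesis by simp
qed

text \<open>A late term \<open>a / b\<close> of a representing sequence is close to
  \<open>x\<close>. Being p-integral and in lowest terms, it has a denominator prime to p, and
  replacing 1 / b by an inverse \<open>c\<close> of \<open>b\<close> modulo p^m turns it into the
  integer \<open>c * a\<close> with an error of valuation at least \<open>m\<close>.\<close>

lemma padic_ints_approx:
  fixes x :: "'p::prime_card padic"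
  assumes x: "x \<in> padic_ints"
  shows "\<exists>a::int. ereal (real m) \<le> padic_val (of_int a - x)"
proof -
  let ?p = "CARD('p)"
  have p: "prime ?p" by (rule prime_card)
  obtain X where X: "padic_Cauchy ?p X" "x = abs_padic X"
    using Quotient_padic[where 'p = 'p] unfolding Quotient_def padic_rel_refl by metis
  obtain N where N: "\<forall>k\<ge>N. \<forall>n\<ge>N. ereal (real m) \<le> rat_val ?p (X k - X n)"
    using X(1) unfolding padic_Cauchy_def by meson
  define y :: "'p padic" where "y = abs_padic (\<lambda>_. X N)"
  have xy: "ereal (real m) \<le> padic_val (x - y)" unfolding X(2)
    by (rule abs_padic_val_diff_ge[OF X(1)])
      (use N in \<open>auto simp: y_def eventually_sequentially\<close>)
  obtain a b where ab: "quotient_of (X N) = (a, b)" by (cases "quotient_of (X N)")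
  hence b: "b > 0" and cop: "coprime a b" and XN: "X N = of_int a / of_int b"
    using quotient_of_denom_pos quotient_of_coprime quotient_of_div by blast+
  have "(of_int b :: 'p padic) * y = abs_padic (\<lambda>n. of_int b * X N)"
    by (simp add: padic_of_int y_def times_padic.abs_eq padic_rel_refl)
  hence b_y: "of_int b * y = (of_int a :: 'p padic)" using b XN by (simp add: padic_of_int)
  have "0 \<le> padic_val (x - (x - y))"
    by (rule padic_val_diff_ge) (use x order_trans[OF _ xy, of 0] in \<open>auto simp: padic_ints_def\<close>)
  hence y0: "0 \<le> padic_val y" by simp
  \<comment> \<open>If p divided \<open>b\<close>, then by integrality of \<open>y\<close> it would
    also divide \<open>b * y = a\<close>, against coprimality.\<close>
  have nd: "\<not> int ?p dvd b"
  proof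
    assume d: "int ?p dvd b"
    hence "ereal (real 1) \<le> padic_val (of_int b :: 'p padic)" unfolding padic_val_of_int_ge_iff by simp
    hence "ereal (real 1) + 0 \<le> padic_val (of_int b * y)"
      unfolding padic_val_mult using y0 by (rule add_mono)
    hence "int ?p dvd a" unfolding b_y using padic_val_of_int_ge_iff[of 1 a, where 'p = 'p] by simp
    with d cop have "is_unit (int ?p)" by (metis coprime_common_divisor)
    thus False using p by auto
  qed
  hence "coprime b (int ?p ^ m)" using p
    by (metis coprime_commute coprime_power_left_iff prime_imp_coprime prime_nat_int_transfer)
  then obtain c where "[b * c = 1] (mod int ?p ^ m)" using cong_solve_coprime_int by blast
  hence "[b * c * a = 1 * a] (mod int ?p ^ m)" by (rule cong_mult) simp
  hence "int ?p ^ m dvd b * (c * a) - a" by (simp add: cong_iff_dvd_diff mult.assoc)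
  hence "ereal (real m) \<le> padic_val (of_int (b * (c * a) - a) :: 'p padic)"
    unfolding padic_val_of_int_ge_iff .
  also have "(of_int (b * (c * a) - a) :: 'p padic) = of_int b * (of_int (c * a) - y)"
    using b_y by (simp add: algebra_simps)
  also have "padic_val \<dots> = padic_val (of_int (c * a) - y)"
    unfolding padic_val_mult using nd b by (simp add: padic_val_of_int not_dvd_imp_multiplicity_0
        del: of_int_mult)
  finally have "ereal (real m) \<le> padic_val (of_int (c * a) - y)" .
  from padic_val_diff_ge[OF this xy] have
    "ereal (real m) \<le> padic_val (of_int (c * a) - y - (x - y))" .
  thus ?thesis by (intro exI[of _ "c * a"]) simp
qed


section \<open>Power series\<close>

text \<open>Open sets and \<open>sums\<close> are given through the metric. This lemma and
  \<open>padic_dist_lessI\<close> translate between small distance and large valuation.\<close>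

lemma padic_dist_lessD:
  fixes x y :: "'p::prime_card padic"
  assumes "dist x y < real CARD('p) powr (- k)"
  shows "ereal k \<le> padic_val (x - y)"
proof (cases "x = y")
  case False
  then obtain c :: int where c: "padic_val (x - y) = ereal (of_int c)"
    using padic_val_integral[of "x - y"] by auto
  have "real CARD('p) > 1" using prime_card[where 'a = 'p] prime_gt_1_nat by fastforce
  thus ?thesis using assms False c by (simp add: dist_padic_def)
qed simp

lemma padic_dist_lessI:
  assumes "e > 0"
  shows "\<exists>m::nat. \<forall>x y :: 'p::prime_card padic. ereal (real m) \<le> padic_val (x - y) \<longrightarrow> dist x y < e"
proof -
  have p1: "real CARD('p) > 1" using prime_card[where 'a = 'p] prime_gt_1_nat by fastforce
  then obtain m where m: "(1 / real CARD('p)) ^ m < e"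
    using real_arch_pow_inv[of e "1 / real CARD('p)"] assms by auto
  have "dist x y < e" if v: "ereal (real m) \<le> padic_val (x - y)" for x y :: "'p padic"
  proof (cases "x = y")
    case False
    then obtain c :: int where c: "padic_val (x - y) = ereal (of_int c)"
      using padic_val_integral[of "x - y"] by auto
    have "dist x y = real CARD('p) powr (- of_int c)" using False c by (simp add: dist_padic_def)
    also have "\<dots> \<le> real CARD('p) powr (- real m)" using v c p1 by (intro powr_mono) auto
    also have "\<dots> = (1 / real CARD('p)) ^ m"
      using p1 by (simp add: powr_minus powr_realpow power_one_over divide_simps)
    finally show ?thesis using m by simp
  qed (use assms in simp)
  thus ?thesis by blast
qed

lemma padic_open_contains_ball:
  fixes x0 :: "'p::prime_card padic"
  assumes "open U" "x0 \<in> U"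
  shows "\<exists>m::nat. \<forall>x. ereal (real m) \<le> padic_val (x - x0) \<longrightarrow> x \<in> U"
proof -
  obtain e where "e > 0" "\<forall>x. dist x x0 < e \<longrightarrow> x \<in> U" using assms open_dist by blast
  thus ?thesis using padic_dist_lessI[of e, where 'p = 'p] by meson
qed

lemma padic_LIMSEQ_val:
  fixes S :: "nat \<Rightarrow> 'p::prime_card padic"
  assumes "S \<longlonglongrightarrow> s"
  shows "\<forall>\<^sub>F n in sequentially. ereal k \<le> padic_val (S n - s)"
proof -
  have "real CARD('p) powr (- k) > 0" by simp
  from tendstoD[OF assms this] show ?thesis
    by eventually_elim (rule padic_dist_lessD)
qed

text \<open>Late partial sums differ from \<open>s\<close> by integral elements, so each late term,
  a difference of two consecutive ones, is integral. Only finitely many terms remain, and no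
  valuation is minus infinity.\<close>

lemma padic_sums_terms_bounded:
  fixes g :: "nat \<Rightarrow> 'p::prime_card padic"
  assumes "g sums s"
  shows "\<exists>b::real. \<forall>n. ereal b \<le> padic_val (g n)"
proof -
  have "\<forall>\<^sub>F n in sequentially. ereal 0 \<le> padic_val (sum g {..<n} - s)"
    using assms unfolding sums_def by (rule padic_LIMSEQ_val)
  then obtain N where N: "\<forall>n\<ge>N. ereal 0 \<le> padic_val (sum g {..<n} - s)"
    by (auto simp: eventually_sequentially)
  have tail: "ereal 0 \<le> padic_val (g n)" if "n \<ge> N" for n
  proof -
    have "ereal 0 \<le> padic_val (sum g {..<Suc n} - s - (sum g {..<n} - s))"
      by (rule padic_val_diff_ge) (use N that in \<open>auto simp del: sum.lessThan_Suc\<close>)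
    thus ?thesis by simp
  qed
  have "\<exists>b::real. \<forall>n<k. ereal b \<le> padic_val (g n)" for k
  proof (induction k)
    case (Suc k)
    then obtain b where b: "\<forall>n<k. ereal b \<le> padic_val (g n)" by blast
    have "\<exists>c::real. ereal c \<le> padic_val (g k)" by (cases "padic_val (g k)") auto
    then obtain c :: real where c: "ereal c \<le> padic_val (g k)" by blast
    have "ereal (min b c) \<le> padic_val (g n)" if "n < Suc k" for n
    proof -
      have le: "ereal (min b c) \<le> ereal b" "ereal (min b c) \<le> ereal c" by auto
      from that consider "n < k" | "n = k" by linarith
      thus ?thesis
      proof cases
        case 1
        thus ?thesis using b order_trans[OF le(1)] by simp
      next
        case 2
        thus ?thesis using c order_trans[OF le(2)] by simp
      qed
    qed
    thus ?case by blast
  qed auto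
  then obtain b where b: "\<forall>n<N. ereal b \<le> padic_val (g n)" by blast
  have "ereal (min b 0) \<le> padic_val (g n)" for n
  proof -
    have le: "ereal (min b 0) \<le> ereal b" "ereal (min b 0) \<le> ereal 0"
      by (simp_all only: ereal_less_eq min.cobounded1 min.cobounded2)
    show ?thesis
    proof (cases "n < N")
      case True
      thus ?thesis using b order_trans[OF le(1)] by simp
    next
      case False
      thus ?thesis using order_trans[OF le(2) tail] by simp
    qed
  qed
  thus ?thesis by blast
qed

text \<open>Write \<open>s\<close> as \<open>g k\<close> plus a finite block of later terms minus
  the error of a late partial sum. Everything except \<open>g k\<close> has valuation at least
  \<open>c + 1\<close>, so the strict ultrametric equality gives the valuation of
  \<open>s\<close>.\<close>

lemma padic_sums_val_eq_dominant:
  fixes g :: "nat \<Rightarrow> 'p::prime_card padic"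
  assumes g: "g sums s" and zero: "\<And>n. n < k \<Longrightarrow> g n = 0"
    and gk: "padic_val (g k) = ereal c" and large: "\<And>n. n > k \<Longrightarrow> ereal (c + 1) \<le> padic_val (g n)"
  shows "padic_val s = ereal c"
proof -
  have "\<forall>\<^sub>F n in sequentially. ereal (c + 1) \<le> padic_val (sum g {..<n} - s)"
    using g unfolding sums_def by (rule padic_LIMSEQ_val)
  then obtain N where N: "\<forall>n\<ge>N. ereal (c + 1) \<le> padic_val (sum g {..<n} - s)"
    by (auto simp: eventually_sequentially)
  define n where "n = max N (Suc k)"
  have "sum g {..<n} = sum g {..<k} + sum g {k..<n}"
    unfolding n_def by (subst sum.atLeastLessThan_concat[of 0 k, simplified lessThan_atLeast0[symmetric]]) auto
  also have "sum g {..<k} = 0" using zero by simp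
  also have "sum g {k..<n} = g k + sum g {Suc k..<n}"
    unfolding n_def by (rule sum.atLeast_Suc_lessThan) simp
  finally have s: "s = g k + (sum g {Suc k..<n} - (sum g {..<n} - s))" by simp
  have "ereal c < ereal (c + 1)" by simp
  also have "\<dots> \<le> padic_val (sum g {Suc k..<n} - (sum g {..<n} - s))"
    by (rule padic_val_diff_ge, rule padic_val_sum_ge) (use N large in \<open>auto simp: n_def\<close>)
  finally show ?thesis using padic_val_add_eq[of "g k"] gk s by metis
qed

text \<open>Convergence at a single point at valuation \<open>M\<close> from \<open>x0\<close>
  bounds the coefficients: v(a n) >= b - n * M. Closer to \<open>x0\<close>, at valuation t, the
  term of index n > k then has valuation at least b + (k + 1) * (t - M), which exceeds \<beta> + k *
  t once t is large.\<close>

lemma padic_power_series_val: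
  fixes f :: "'p::prime_card padic \<Rightarrow> 'p padic"
  assumes sums: "\<And>x. ereal (real M) \<le> padic_val (x - x0) \<Longrightarrow> x \<in> padic_ints \<Longrightarrow>
      (\<lambda>n. a n * (x - x0) ^ n) sums f x"
    and x0: "x0 \<in> padic_ints" and ak: "a k \<noteq> 0" and less: "\<And>n. n < k \<Longrightarrow> a n = 0"
  shows "\<exists>(\<beta>::int) (m::nat). \<forall>x\<in>padic_ints. ereal (real m) \<le> padic_val (x - x0) \<longrightarrow>
    padic_val (f x) = ereal (of_int \<beta>) + ereal (of_nat k) * padic_val (x - x0)"
proof -
  obtain \<beta> :: int where \<beta>: "padic_val (a k) = ereal (of_int \<beta>)" using padic_val_integral[OF ak] by blast
  define q :: "'p padic" where "q = of_int (int CARD('p) ^ M)"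
  have "\<not> is_unit (int CARD('p))" "int CARD('p) \<noteq> 0" using prime_card[where 'a = 'p] by auto
  hence q: "padic_val q = ereal (real M)"
    unfolding q_def padic_val_of_int by (simp add: multiplicity_same_power)
  have "x0 + q \<in> padic_ints"
    using x0 unfolding padic_ints_def by (auto intro!: padic_val_add_ge simp: q)
  hence "(\<lambda>n. a n * q ^ n) sums f (x0 + q)" using sums[of "x0 + q"] q by simp
  then obtain b where b: "\<And>n. ereal b \<le> padic_val (a n * q ^ n)"
    using padic_sums_terms_bounded by blast
  \<comment> \<open>The first bound is b + (k + 1) * (t - M) >= \<beta> + k * t + 1, solved for t.
    The second keeps \<open>x\<close> where the series converges and makes t - M
    nonnegative.\<close>
  obtain m :: nat where m: "of_int \<beta> - b + (real k + 1) * M + 1 \<le> real m" "M \<le> m"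
  proof -
    obtain j :: nat where "of_int \<beta> - b + (real k + 1) * M + 1 \<le> real j" using real_arch_simple by blast
    thus ?thesis by (intro that[of "max j M"]) auto
  qed
  have "padic_val (f x) = ereal (of_int \<beta>) + ereal (of_nat k) * padic_val (x - x0)"
    if x: "x \<in> padic_ints" and v: "ereal (real m) \<le> padic_val (x - x0)" for x
  proof -
    have "ereal (real M) \<le> padic_val (x - x0)" using m v by (meson ereal_less_eq(3) of_nat_mono order_trans)
    from sums[OF this x] have sx: "(\<lambda>n. a n * (x - x0) ^ n) sums f x" .
    show ?thesis
    proof (cases "x = x0")
      \<comment> \<open>At the centre only \<open>a 0\<close> survives. For k = 0 the formula still
        holds because 0 times infinity is 0 in \<open>ereal\<close>; for k > 0 both sides are
        infinite.\<close>
      case True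
      have "(\<lambda>n. a n * (x - x0) ^ n) = (\<lambda>n. if n = 0 then a 0 else 0)" using True by auto
      moreover have "(\<lambda>n. if n = 0 then a 0 else 0) sums a 0"
        unfolding sums_def by (rule tendsto_eventually)
          (auto simp: eventually_sequentially sum.delta intro!: exI[of _ 1])
      ultimately have "(\<lambda>n. a n * (x - x0) ^ n) sums a 0" by simp
      with sx have fx: "f x = a 0" by (rule sums_unique2)
      show ?thesis
      proof (cases "k = 0")
        case True
        thus ?thesis using fx \<beta> by (simp flip: zero_ereal_def)
      next
        case False
        thus ?thesis using fx \<open>x = x0\<close> less[of 0] by simp
      qed
    next
      case False
      then obtain t' :: int where t': "padic_val (x - x0) = ereal (of_int t')"
        using padic_val_integral[of "x - x0"] by auto
      define t :: real where "t = of_int t'"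
      have t: "padic_val (x - x0) = ereal t" "real m \<le> t" using v t' by (auto simp: t_def)
      have "padic_val (f x) = ereal (of_int \<beta> + real k * t)"
      proof (rule padic_sums_val_eq_dominant[OF sx])
        show "padic_val (a k * (x - x0) ^ k) = ereal (of_int \<beta> + real k * t)"
          using \<beta> padic_val_power[OF t(1)] by (simp add: padic_val_mult)
        show "ereal (of_int \<beta> + real k * t + 1) \<le> padic_val (a n * (x - x0) ^ n)" if n: "n > k" for n
        proof (cases "a n = 0")
          case False
          then obtain c :: int where c: "padic_val (a n) = ereal (of_int c)"
            using padic_val_integral by blast
          have bn: "b \<le> of_int c + real n * real M"
            using b[of n] by (simp add: padic_val_mult c padic_val_power[OF q])
          have "(real k + 1) * (t - real M) \<le> real n * (t - real M)"
            using n m t by (intro mult_right_mono) auto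
          hence "of_int \<beta> + real k * t + 1 \<le> of_int c + real n * t"
            using bn m(1) t(2) by (simp add: algebra_simps)
          thus ?thesis by (simp add: padic_val_mult c padic_val_power[OF t(1)])
        qed simp
      qed (use less in auto)
      thus ?thesis using t by simp
    qed
  qed
  thus ?thesis by blast
qed

text \<open>Either all coefficients at \<open>x0\<close> vanish, or there is a first nonzero one, of
  index \<open>k\<close>. The value k = 0 is allowed and means that the valuation is locally
  constant.\<close>

lemma padic_locally_analytic_val:
  fixes f :: "'p::prime_card padic \<Rightarrow> 'p padic"
  assumes f: "padic_locally_analytic f" and x0: "x0 \<in> padic_ints"
  obtains (zero) m :: nat where "\<forall>x\<in>padic_ints. ereal (real m) \<le> padic_val (x - x0) \<longrightarrow> f x = 0"
  | (monomial) \<beta> :: int and k m :: nat where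
      "\<forall>x\<in>padic_ints. ereal (real m) \<le> padic_val (x - x0) \<longrightarrow>
        padic_val (f x) = ereal (of_int \<beta>) + ereal (of_nat k) * padic_val (x - x0)"
proof -
  obtain U a where U: "open U" "x0 \<in> U"
    and a: "\<forall>x\<in>U \<inter> padic_ints. (\<lambda>n. a n * (x - x0) ^ n) sums f x"
    using f x0 unfolding padic_locally_analytic_def by blast
  obtain M :: nat where "\<forall>x. ereal (real M) \<le> padic_val (x - x0) \<longrightarrow> x \<in> U"
    using padic_open_contains_ball[OF U] by blast
  hence sums: "(\<lambda>n. a n * (x - x0) ^ n) sums f x"
    if "ereal (real M) \<le> padic_val (x - x0)" "x \<in> padic_ints" for x
    using a that by blast
  show ?thesis
  proof (cases "\<forall>n. a n = 0")
    case True
    have "f x = 0" if "ereal (real M) \<le> padic_val (x - x0)" "x \<in> padic_ints" for x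
      using sums[OF that] True sums_unique2[OF sums_zero] by simp
    thus ?thesis using zero by blast
  next
    case False
    define k where "k = (LEAST k. a k \<noteq> 0)"
    have "a k \<noteq> 0" unfolding k_def using False by (intro LeastI_ex[of "\<lambda>k. a k \<noteq> 0"]) auto
    moreover have "a n = 0" if "n < k" for n using not_less_Least that unfolding k_def by blast
    ultimately show ?thesis using padic_power_series_val[OF sums x0] monomial by blast
  qed
qed

section \<open>Compactness of the p-adic integers\<close>

lemma cong_class_self [simp]: "a \<in> cong_class a d"
  by (simp add: cong_class_def)

lemma cong_class_eq_iff: "cong_class a d = cong_class b d \<longleftrightarrow> [a = b] (mod int d)"
proof
  show "cong_class a d = cong_class b d \<Longrightarrow> [a = b] (mod int d)"
    using cong_class_self[of a d] by (simp add: cong_class_def)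
  show "[a = b] (mod int d) \<Longrightarrow> cong_class a d = cong_class b d"
    by (auto simp: cong_class_def cong_def)
qed

lemma cong_class_antimono:
  assumes "d dvd e"
  shows "cong_class a e \<subseteq> cong_class a d"
proof -
  have "int d dvd int e" using assms by simp
  from dvd_trans[OF this] show ?thesis unfolding cong_class_def cong_iff_dvd_diff by blast
qed

text \<open>If n - c = p^m * k, the residue of \<open>k\<close> modulo p selects the subclass of
  \<open>n\<close>. Index 0 keeps the centre \<open>c\<close>, which later makes it the nonconstant
  subclass.\<close>

lemma cong_class_split:
  fixes c :: int and m p :: nat
  assumes p: "p > 0"
  defines "D \<equiv> \<lambda>i. cong_class (c + int i * int p ^ m) (p ^ (m + 1))"
  shows "cong_class c (p ^ m) = (\<Union>i<p. D i)" and "disjoint_family_on D {..<p}"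
proof -
  have "cong_class (c + int i * int p ^ m) (p ^ (m + 1)) \<subseteq> cong_class (c + int i * int p ^ m) (p ^ m)" for i
    by (rule cong_class_antimono) simp
  moreover have "cong_class (c + int i * int p ^ m) (p ^ m) = cong_class c (p ^ m)" for i
    by (simp add: cong_class_eq_iff cong_iff_dvd_diff)
  ultimately have sub: "D i \<subseteq> cong_class c (p ^ m)" for i unfolding D_def by blast
  have "n \<in> (\<Union>i<p. D i)" if "n \<in> cong_class c (p ^ m)" for n
  proof -
    from that obtain k where k: "n - c = int p ^ m * k"
      by (auto simp: cong_class_def cong_iff_dvd_diff dvd_def)
    define i where "i = nat (k mod int p)"
    have i: "int i = k mod int p" "i < p" using p by (auto simp: i_def nat_less_iff)
    have "n - (c + int i * int p ^ m) = int p ^ m * (k - k mod int p)"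
      using k by (simp add: i algebra_simps)
    also have "\<dots> = int p ^ (m + 1) * (k div int p)" by (simp add: minus_mod_eq_mult_div)
    finally have "n \<in> D i" by (simp add: D_def cong_class_def cong_iff_dvd_diff)
    thus ?thesis using i by blast
  qed
  with sub show "cong_class c (p ^ m) = (\<Union>i<p. D i)" by blast
  show "disjoint_family_on D {..<p}"
    unfolding disjoint_family_on_def
  proof (intro ballI impI equals0I)
    fix i j n assume ij: "i \<in> {..<p}" "j \<in> {..<p}" "i \<noteq> j" and n: "n \<in> D i \<inter> D j"
    hence "[c + int i * int p ^ m = c + int j * int p ^ m] (mod int (p ^ (m + 1)))"
      unfolding D_def cong_class_def by (auto intro: cong_trans cong_sym)
    hence "int p ^ m * int p dvd int p ^ m * (int i - int j)"
      by (simp add: cong_iff_dvd_diff algebra_simps)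
    hence "int p dvd int i - int j" using p by simp
    hence "int i mod int p = int j mod int p" by (simp add: mod_eq_dvd_iff)
    thus False using ij by simp
  qed
qed

text \<open>The integers \<open>s\<close>, read as rationals, form a Cauchy sequence and so
  represent the limit themselves.\<close>

lemma padic_limit_of_ints:
  assumes s: "\<And>m. [s (Suc m) = s m] (mod int CARD('p::prime_card) ^ m)"
  shows "\<exists>x::'p padic. \<forall>m. ereal (real m) \<le> padic_val (of_int (s m) - x)"
proof -
  let ?p = "CARD('p)"
  have dvd: "int ?p ^ m dvd s n - s m" if "m \<le> n" for m n
    using that
  proof (induction n rule: dec_induct)
    case (step n)
    have "int ?p ^ m dvd int ?p ^ n" using step by (intro le_imp_power_dvd)
    hence "int ?p ^ m dvd s (Suc n) - s n"
      using s[of n] unfolding cong_iff_dvd_diff by (rule dvd_trans)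
    from dvd_add[OF this step.IH] show ?case by simp
  qed simp
  have val: "ereal (real m) \<le> rat_val ?p (of_int (s n) - of_int (s m))" if "m \<le> n" for m n
  proof (cases "s n = s m")
    case False
    have "\<not> is_unit (int ?p)" using prime_card[where 'a = 'p] by auto
    hence "m \<le> multiplicity (int ?p) (s n - s m)"
      using dvd[OF that] False by (simp add: power_dvd_iff_le_multiplicity)
    thus ?thesis using False rat_val_of_int[of ?p "s n - s m"] by simp
  qed simp
  define X :: "nat \<Rightarrow> rat" where "X = (\<lambda>n. of_int (s n))"
  have X: "padic_Cauchy ?p X"
    unfolding padic_Cauchy_def
  proof
    fix k :: real
    obtain N :: nat where N: "k \<le> real N" using real_arch_simple by blast
    have "ereal k \<le> rat_val ?p (X m - X n)" if "m \<ge> N" "n \<ge> N" for m n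
    proof -
      have "ereal (real N) \<le> rat_val ?p ((X m - X N) + - (X n - X N))"
        using val that by (intro rat_val_add_ge[OF prime_card]) (auto simp: X_def simp del: minus_diff_eq)
      thus ?thesis using N by (simp add: order_trans[of "ereal k" "ereal (real N)"])
    qed
    thus "\<exists>N. \<forall>m\<ge>N. \<forall>n\<ge>N. ereal k \<le> rat_val ?p (X m - X n)" by blast
  qed
  have "ereal (real m) \<le> padic_val (abs_padic X - of_int (s m) :: 'p padic)" for m
    by (rule abs_padic_val_diff_ge[OF X])
      (use val[of m] in \<open>auto simp: X_def padic_of_int eventually_sequentially\<close>)
  thus ?thesis by (metis padic_val_diff_commute)
qed

text \<open>If no level \<open>M\<close> worked, some sequence of nested classes would avoid \<open>Q\<close> for ever, and
  \<open>Q\<close> would fail near its limit.\<close>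

lemma padic_ints_uniform_level:
  assumes mono: "\<And>a m m'. Q a m \<Longrightarrow> m \<le> m' \<Longrightarrow> Q a m'"
    and local: "\<And>x :: 'p::prime_card padic. x \<in> padic_ints \<Longrightarrow>
      \<exists>m::nat. \<forall>a. ereal (real m) \<le> padic_val (of_int a - x) \<longrightarrow> Q a m"
  shows "\<exists>M. \<forall>a. Q a M"
proof -
  let ?p = "CARD('p)"
  have p: "?p > 0" by simp
  \<comment> \<open>\<open>R a m\<close> asks for some common level on the whole class, which may be
    far deeper than \<open>m\<close>.\<close>
  define R where "R = (\<lambda>a m. \<exists>M. \<forall>b\<in>cong_class a (?p ^ m). Q b M)"
  \<comment> \<open>If every one of the p subclasses had a common level, the largest of these levels
    would serve the whole class.\<close>
  have step: "\<exists>b. \<not> R b (Suc m) \<and> [b = a] (mod int ?p ^ m)" if "\<not> R a m" for a m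
  proof (rule ccontr)
    assume *: "\<not> (\<exists>b. \<not> R b (Suc m) \<and> [b = a] (mod int ?p ^ m))"
    have "R (a + int i * int ?p ^ m) (Suc m)" for i
      using * by (auto simp: cong_iff_dvd_diff)
    then obtain M where M: "\<And>i b. b \<in> cong_class (a + int i * int ?p ^ m) (?p ^ (m + 1)) \<Longrightarrow> Q b (M i)"
      unfolding R_def by (metis Suc_eq_plus1)
    have max: "Q b (Max (M ` {..<?p}))" if "b \<in> cong_class a (?p ^ m)" for b
    proof -
      have "b \<in> (\<Union>i<?p. cong_class (a + int i * int ?p ^ m) (?p ^ (m + 1)))"
        using that cong_class_split(1)[OF p, of a m] by (rule back_subst[of "\<lambda>C. b \<in> C"])
      then obtain i where "i < ?p" "b \<in> cong_class (a + int i * int ?p ^ m) (?p ^ (m + 1))"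
        by blast
      with M have "Q b (M i)" "M i \<le> Max (M ` {..<?p})" by auto
      thus ?thesis by (rule mono)
    qed
    have "R a m" unfolding R_def by (rule exI, rule ballI, rule max)
    thus False using that by simp
  qed
  \<comment> \<open>The class of 0 modulo p^0 consists of all integers.\<close>
  have "R 0 0"
  proof (rule ccontr)
    assume "\<not> R 0 0"
    hence "\<exists>s. \<forall>m. \<not> R (s m) m \<and> [s (Suc m) = s m] (mod int ?p ^ m)"
      using step by (intro dependent_nat_choice) auto
    then obtain s where s: "\<And>m. \<not> R (s m) m" "\<And>m. [s (Suc m) = s m] (mod int ?p ^ m)" by blast
    obtain x :: "'p padic" where x: "\<And>m. ereal (real m) \<le> padic_val (of_int (s m) - x)"
      using padic_limit_of_ints[OF s(2)] by blast
    have "0 \<le> padic_val (of_int (s 0) - (of_int (s 0) - x))"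
      by (rule padic_val_diff_ge)
        (use x[of 0] in \<open>auto simp: padic_val_of_int zero_ereal_def\<close>)
    hence "x \<in> padic_ints" by (simp add: padic_ints_def)
    then obtain m where m: "\<And>a. ereal (real m) \<le> padic_val (of_int a - x) \<Longrightarrow> Q a m" using local by blast
    \<comment> \<open>Every member of the class of \<open>s m\<close> modulo p^m is within valuation
      \<open>m\<close> of the limit, so the one level \<open>m\<close> serves this whole class,
      against the choice of \<open>s\<close>.\<close>
    have "Q b m" if "b \<in> cong_class (s m) (?p ^ m)" for b
    proof (rule m)
      have "ereal (real m) \<le> padic_val (of_int b - of_int (s m) + (of_int (s m) - x))"
        using that x by (intro padic_val_add_ge) (auto simp: cong_class_iff_padic_val)
      thus "ereal (real m) \<le> padic_val (of_int b - x)" by simp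
    qed
    thus False using s(1) unfolding R_def by blast
  qed
  thus ?thesis by (simp add: R_def cong_class_def)
qed


section \<open>Balls of integers around a p-adic integer\<close>

text \<open>The centre need not be an integer: one p-adic integer \<open>x\<close> names a
  congruence class at every level, with no choice of representatives.\<close>

definition int_ball :: "'p::prime_card padic \<Rightarrow> nat \<Rightarrow> int set" where
  "int_ball x m = {n. ereal (real m) \<le> padic_val (of_int n - x)}"

text \<open>By the ultrametric inequality every point of a ball is a centre of it.\<close>

lemma int_ball_eq_cong_class:
  fixes x :: "'p::prime_card padic"
  assumes "a \<in> int_ball x m"
  shows "int_ball x m = cong_class a (CARD('p) ^ m)"
proof -
  have a: "ereal (real m) \<le> padic_val (of_int a - x)" using assms by (simp add: int_ball_def)
  have "n \<in> int_ball x m \<longleftrightarrow> n \<in> cong_class a (CARD('p) ^ m)" for n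
    unfolding int_ball_def mem_Collect_eq cong_class_iff_padic_val[where 'p = 'p]
    using padic_val_diff_ge[of _ "of_int n - x" "of_int a - x", OF _ a]
      padic_val_add_ge[of _ "of_int n - of_int a" "of_int a - x", OF _ a] by auto
  thus ?thesis by blast
qed

lemma int_ball_antimono:
  assumes "m \<le> m'"
  shows "int_ball x m' \<subseteq> int_ball x m"
proof -
  have "ereal (real m) \<le> ereal (real m')" using assms by simp
  from order_trans[OF this] show ?thesis unfolding int_ball_def by blast
qed

lemma int_ball_nonempty: "x \<in> padic_ints \<Longrightarrow> \<exists>a. a \<in> int_ball x m"
  using padic_ints_approx unfolding int_ball_def by blast

text \<open>Supplies the points at which minima are attained and nonconstancy is seen. Take an
  integer \<open>c\<close> nearer to \<open>x\<close> than required; adding p^m brings the valuation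
  of the difference to exactly \<open>m\<close>, and a multiple of p^(m+1) makes the sum positive
  without disturbing it.\<close>

lemma int_ball_positive_exact:
  fixes x :: "'p::prime_card padic"
  assumes x: "x \<in> padic_ints"
  obtains n where "n > 0" "padic_val (of_int n - x) = ereal (real m)"
proof -
  let ?p = "CARD('p)"
  obtain c where c: "ereal (real (Suc m)) \<le> padic_val (of_int c - x)"
    using padic_ints_approx[OF x] by blast
  define k where "k = \<bar>c\<bar> * int ?p ^ Suc m"
  define n where "n = int ?p ^ m + (k + c)"
  have pos: "int ?p ^ j > 0" for j by simp
  have "\<bar>c\<bar> * 1 \<le> k" unfolding k_def using pos[of "Suc m"] by (intro mult_left_mono) linarith+
  hence "n > 0" using pos[of m] unfolding n_def by linarith
  moreover have "padic_val (of_int n - x) = ereal (real m)"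
  proof -
    have "\<not> is_unit (int ?p)" "int ?p \<noteq> 0" using prime_card[where 'a = 'p] by auto
    hence v: "padic_val (of_int (int ?p ^ m) :: 'p padic) = ereal (real m)"
      unfolding padic_val_of_int by (simp add: multiplicity_same_power)
    have "ereal (real (Suc m)) \<le> padic_val (of_int k + (of_int c - x))"
      using c by (intro padic_val_add_ge) (auto simp only: padic_val_of_int_ge_iff k_def dvd_triv_right)
    moreover have "ereal (real m) < ereal (real (Suc m))" by simp
    ultimately have "padic_val (of_int (int ?p ^ m) :: 'p padic) < padic_val (of_int k + (of_int c - x))"
      unfolding v by (rule less_le_trans[rotated])
    from padic_val_add_eq[OF this] show ?thesis
      unfolding v n_def by (simp add: algebra_simps)
  qed
  ultimately show ?thesis by (rule that)
qed


section \<open>Classes on which the valuation is affine in the distance to a point\<close>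

text \<open>Nonpositive members of \<open>C\<close> are included, as in the final formula for
  v(f(n)), whereas \<open>constant_class\<close> and \<open>val_set\<close> look at positive members
  only.\<close>

definition affine_val_on ::
  "('p::prime_card padic \<Rightarrow> 'p padic) \<Rightarrow> int set \<Rightarrow> int \<Rightarrow> nat \<Rightarrow> 'p padic \<Rightarrow> bool" where
  "affine_val_on f C \<beta> l x0 \<longleftrightarrow> (\<forall>n\<in>C. padic_val (f (of_int n)) =
     ereal (of_int \<beta>) + ereal (of_nat l) * padic_val (of_int n - x0))"

lemma affine_val_on_mono: "affine_val_on f C \<beta> l x0 \<Longrightarrow> D \<subseteq> C \<Longrightarrow> affine_val_on f D \<beta> l x0"
  unfolding affine_val_on_def by blast

lemma constant_class_mono: "constant_class f C t \<Longrightarrow> D \<subseteq> C \<Longrightarrow> constant_class f D t"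
  unfolding constant_class_def by blast

lemma nonconstant_class_mono: "nonconstant_class f D \<Longrightarrow> D \<subseteq> C \<Longrightarrow> nonconstant_class f C"
  unfolding nonconstant_class_def using constant_class_mono by blast

text \<open>The valuation of n - x is at least \<open>m\<close> on the ball, and some positive
  \<open>n\<close> attains \<open>m\<close>; the affine expression is monotone in it, infinity
  included.\<close>

lemma min_val_affine:
  fixes x :: "'p::prime_card padic"
  assumes x: "x \<in> padic_ints" and aff: "affine_val_on f (int_ball x m) \<beta> l x"
  shows "min_val f (int_ball x m) = ereal (of_int \<beta> + real l * real m)"
  unfolding min_val_def
proof (rule Least_equality)
  obtain n where n: "n > 0" "padic_val (of_int n - x) = ereal (real m)"
    using int_ball_positive_exact[OF x] .
  moreover from n have "n \<in> int_ball x m" by (simp add: int_ball_def)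
  ultimately show "ereal (of_int \<beta> + real l * real m) \<in> val_set f (int_ball x m)"
    using aff unfolding val_set_def affine_val_on_def by force
next
  fix t assume "t \<in> val_set f (int_ball x m)"
  then obtain n where n: "t = padic_val (f (of_int n))" "n \<in> int_ball x m" by (auto simp: val_set_def)
  hence "t = ereal (of_int \<beta>) + ereal (real l) * padic_val (of_int n - x)"
    using aff by (simp add: affine_val_on_def)
  moreover have "ereal (of_int \<beta>) + ereal (real l) * ereal (real m) \<le>
      ereal (of_int \<beta>) + ereal (real l) * padic_val (of_int n - x)"
    using n(2) unfolding int_ball_def by (intro add_left_mono ereal_mult_left_mono) auto
  ultimately show "ereal (of_int \<beta> + real l * real m) \<le> t" by simp
qed

text \<open>Positive members at valuations \<open>m\<close> and \<open>m + 1\<close> from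
  \<open>x\<close> give values that differ by \<open>l\<close>.\<close>

lemma nonconstant_class_affine:
  fixes x :: "'p::prime_card padic"
  assumes x: "x \<in> padic_ints" and aff: "affine_val_on f (int_ball x m) \<beta> l x" and l: "l > 0"
  shows "nonconstant_class f (int_ball x m)"
  unfolding nonconstant_class_def
proof
  assume "\<exists>t. constant_class f (int_ball x m) t"
  then obtain t where t: "constant_class f (int_ball x m) t" by blast
  have val: "t = ereal (of_int \<beta> + real l * real k)" if "k \<ge> m" for k
  proof -
    obtain n where n: "n > 0" "padic_val (of_int n - x) = ereal (real k)"
      using int_ball_positive_exact[OF x] .
    hence "n \<in> int_ball x m" using that by (simp add: int_ball_def)
    with n t aff show ?thesis by (force simp: constant_class_def affine_val_on_def)
  qed
  from val[of m] val[of "Suc m"] l show False by simp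
qed

lemma constant_class_affine:
  assumes aff: "affine_val_on f (int_ball x m) \<beta> l x"
  shows "constant_class f (int_ball x m - int_ball x (Suc m)) (ereal (of_int \<beta> + real l * real m))"
  unfolding constant_class_def
proof (intro ballI impI)
  fix n assume "n \<in> int_ball x m - int_ball x (Suc m)"
  hence "padic_val (of_int n - x) = ereal (real m)" "n \<in> int_ball x m"
    using padic_val_Suc_leI[of m "of_int n - x"] by (auto simp: int_ball_def)
  with aff show "padic_val (f (of_int n)) = ereal (of_int \<beta> + real l * real m)"
    by (auto simp: affine_val_on_def)
qed

text \<open>One subclass is the next smaller ball around \<open>x\<close>, where the minimum grows
  by \<open>l\<close>. The others are disjoint from it, so they lie in the shell at valuation
  exactly \<open>m\<close>.\<close>

lemma int_ball_split:
  fixes f :: "'p::prime_card padic \<Rightarrow> 'p padic"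
  defines "p \<equiv> CARD('p)"
  assumes x: "x \<in> padic_ints" and aff: "affine_val_on f (int_ball x m) \<beta> l x" and l: "l > 0"
  shows "\<exists>a :: nat \<Rightarrow> int.
    int_ball x m = (\<Union>i<p. cong_class (a i) (p ^ (m + 1))) \<and>
    disjoint_family_on (\<lambda>i. cong_class (a i) (p ^ (m + 1))) {..<p} \<and>
    (\<forall>i\<in>{1..<p}. constant_class f (cong_class (a i) (p ^ (m + 1))) (min_val f (int_ball x m))) \<and>
    nonconstant_class f (cong_class (a 0) (p ^ (m + 1))) \<and>
    min_val f (cong_class (a 0) (p ^ (m + 1))) > min_val f (int_ball x m)"
proof -
  \<comment> \<open>Taking \<open>c\<close> from the ball of level \<open>Suc m\<close> makes the
    subclass of index 0 that very ball.\<close>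
  obtain c where c: "c \<in> int_ball x (Suc m)" using int_ball_nonempty[OF x] by blast
  define a where "a = (\<lambda>i. c + int i * int p ^ m)"
  have p: "p > 0" by (simp add: p_def)
  have sub: "int_ball x (Suc m) \<subseteq> int_ball x m" by (rule int_ball_antimono) simp
  have "int_ball x m = cong_class c (p ^ m)"
    unfolding p_def using c sub by (intro int_ball_eq_cong_class) blast
  hence un: "int_ball x m = (\<Union>i<p. cong_class (a i) (p ^ (m + 1)))"
    unfolding a_def using cong_class_split(1)[OF p] by simp
  have disj: "disjoint_family_on (\<lambda>i. cong_class (a i) (p ^ (m + 1))) {..<p}"
    unfolding a_def by (rule cong_class_split(2)[OF p])
  have a0: "cong_class (a 0) (p ^ (m + 1)) = int_ball x (Suc m)"
    unfolding p_def using int_ball_eq_cong_class[OF c] by (simp add: a_def)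
  have aff': "affine_val_on f (int_ball x (Suc m)) \<beta> l x" by (rule affine_val_on_mono[OF aff sub])
  have "constant_class f (cong_class (a i) (p ^ (m + 1))) (min_val f (int_ball x m))"
    if i: "i \<in> {1..<p}" for i
    unfolding min_val_affine[OF x aff]
  proof (rule constant_class_mono[OF constant_class_affine[OF aff]])
    have "cong_class (a i) (p ^ (m + 1)) \<inter> cong_class (a 0) (p ^ (m + 1)) = {}"
      using disj i p unfolding disjoint_family_on_def by auto
    moreover have "cong_class (a i) (p ^ (m + 1)) \<subseteq> int_ball x m" unfolding un using i by auto
    ultimately show "cong_class (a i) (p ^ (m + 1)) \<subseteq> int_ball x m - int_ball x (Suc m)"
      unfolding a0 by blast
  qed
  moreover have "nonconstant_class f (int_ball x (Suc m))"
    by (rule nonconstant_class_affine[OF x aff' l])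
  moreover have "min_val f (int_ball x (Suc m)) > min_val f (int_ball x m)"
    unfolding min_val_affine[OF x aff] min_val_affine[OF x aff'] using l by simp
  ultimately show ?thesis using un disj a0 by (intro exI[of _ a]) auto
qed

text \<open>If \<open>a\<close> lay outside the ball, all members of its class would be equally far
  from \<open>x\<close>, and the affine formula would make the class constant.\<close>

lemma nonconstant_affine_class_is_ball:
  fixes f :: "'p::prime_card padic \<Rightarrow> 'p padic"
  assumes nc: "nonconstant_class f (cong_class a (CARD('p) ^ m))"
    and aff: "affine_val_on f (cong_class a (CARD('p) ^ m)) \<beta> l x"
  shows "cong_class a (CARD('p) ^ m) = int_ball x m"
proof (cases "a \<in> int_ball x m")
  case True
  thus ?thesis using int_ball_eq_cong_class by blast
next
  case False
  have same: "padic_val (of_int n - x) = padic_val (of_int a - x)" if "n \<in> cong_class a (CARD('p) ^ m)" for n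
  proof -
    have "padic_val (of_int a - x) < ereal (real m)" using False by (simp add: int_ball_def not_le)
    also have "\<dots> \<le> padic_val (of_int n - of_int a :: 'p padic)" using that unfolding cong_class_iff_padic_val .
    finally have "padic_val (of_int a - x) < padic_val (of_int n - of_int a :: 'p padic)" .
    from padic_val_add_eq[OF this] show ?thesis by simp
  qed
  have "constant_class f (cong_class a (CARD('p) ^ m))
      (ereal (of_int \<beta>) + ereal (of_nat l) * padic_val (of_int a - x))"
    using aff unfolding constant_class_def affine_val_on_def by (metis same)
  thus ?thesis using nc unfolding nonconstant_class_def by blast
qed

text \<open>The property given to \<open>padic_ints_uniform_level\<close> is an implication: it
  passes to subclasses since nonconstancy goes up and the affine formula goes down. The zero case
  and the exponent 0 yield constant classes, so only l > 0 remains.\<close>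

lemma locally_analytic_affine_level:
  fixes f :: "'p::prime_card padic \<Rightarrow> 'p padic"
  assumes f: "padic_locally_analytic f"
  shows "\<exists>M. \<forall>a. nonconstant_class f (cong_class a (CARD('p) ^ M)) \<longrightarrow>
    (\<exists>\<beta> l x. l > 0 \<and> x \<in> padic_ints \<and> affine_val_on f (cong_class a (CARD('p) ^ M)) \<beta> l x)"
proof (rule padic_ints_uniform_level[where 'p = 'p])
  fix a m m'
  assume Q: "nonconstant_class f (cong_class a (CARD('p) ^ m)) \<longrightarrow>
    (\<exists>\<beta> l x. l > 0 \<and> x \<in> padic_ints \<and> affine_val_on f (cong_class a (CARD('p) ^ m)) \<beta> l x)"
    and "m \<le> m'"
  hence sub: "cong_class a (CARD('p) ^ m') \<subseteq> cong_class a (CARD('p) ^ m)"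
    by (intro cong_class_antimono le_imp_power_dvd)
  show "nonconstant_class f (cong_class a (CARD('p) ^ m')) \<longrightarrow>
    (\<exists>\<beta> l x. l > 0 \<and> x \<in> padic_ints \<and> affine_val_on f (cong_class a (CARD('p) ^ m')) \<beta> l x)"
    using Q nonconstant_class_mono[OF _ sub] affine_val_on_mono[OF _ sub] by meson
next
  fix x :: "'p padic" assume x: "x \<in> padic_ints"
  have near: "ereal (real m) \<le> padic_val (of_int n - x)"
    if "ereal (real m) \<le> padic_val (of_int a - x)" "n \<in> cong_class a (CARD('p) ^ m)" for a n m
    using int_ball_eq_cong_class[of a x m] that by (auto simp: int_ball_def)
  from f x show "\<exists>m. \<forall>a. ereal (real m) \<le> padic_val (of_int a - x) \<longrightarrow>
    nonconstant_class f (cong_class a (CARD('p) ^ m)) \<longrightarrow>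
    (\<exists>\<beta> l x. l > 0 \<and> x \<in> padic_ints \<and> affine_val_on f (cong_class a (CARD('p) ^ m)) \<beta> l x)"
  proof (cases rule: padic_locally_analytic_val)
    case (zero m)
    have "constant_class f (cong_class a (CARD('p) ^ m)) \<infinity>"
      if "ereal (real m) \<le> padic_val (of_int a - x)" for a
      using zero near[OF that] unfolding constant_class_def by simp
    thus ?thesis unfolding nonconstant_class_def by blast
  next
    case (monomial \<beta> k m)
    have aff: "affine_val_on f (cong_class a (CARD('p) ^ m)) \<beta> k x"
      if "ereal (real m) \<le> padic_val (of_int a - x)" for a
      using monomial near[OF that] unfolding affine_val_on_def by simp
    show ?thesis
    proof (cases "k = 0")
      case True
      have "constant_class f (cong_class a (CARD('p) ^ m)) (ereal (of_int \<beta>))"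
        if "ereal (real m) \<le> padic_val (of_int a - x)" for a
        using aff[OF that] True unfolding affine_val_on_def constant_class_def
        by (simp flip: zero_ereal_def)
      thus ?thesis unfolding nonconstant_class_def by blast
    next
      case False
      thus ?thesis using aff x by blast
    qed
  qed
qed

section \<open>From one uniform level to all deeper levels\<close>

theorem theorem2:
  fixes f :: "'p::prime_card padic \<Rightarrow> 'p padic" and p :: nat
  assumes p: "p = CARD('p)"
    and f: "padic_locally_analytic f"
  shows "\<exists>m0 \<mu> :: nat. m0 > 0 \<and>
    (\<forall>m\<ge>m0.
      card (nonconstant_classes f (p ^ m)) = \<mu> \<and>
      (\<forall>C\<in>nonconstant_classes f (p ^ m).
        \<exists>a :: nat \<Rightarrow> int.
          C = (\<Union>i<p. cong_class (a i) (p ^ (m + 1))) \<and>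
          disjoint_family_on (\<lambda>i. cong_class (a i) (p ^ (m + 1))) {..<p} \<and>
          (\<forall>i\<in>{1..<p}. constant_class f (cong_class (a i) (p ^ (m + 1))) (min_val f C)) \<and>
          nonconstant_class f (cong_class (a 0) (p ^ (m + 1))) \<and>
          min_val f (cong_class (a 0) (p ^ (m + 1))) > min_val f C)) \<and>
    (\<forall>C\<in>nonconstant_classes f (p ^ m0).
      (\<exists>(\<beta>::int) (l::nat). \<exists>x0\<in>(padic_ints :: 'p padic set). l > 0 \<and>
        (\<forall>n\<in>C. padic_val (f (of_int n)) =
          ereal (of_int \<beta>) + ereal (of_nat l) * padic_val (of_int n - x0))) \<and>
      (\<exists>(\<alpha>::int) (l::nat). l > 0 \<and>
        (\<forall>m\<ge>m0. (\<exists>!D. D \<in> nonconstant_classes f (p ^ m) \<and> D \<subseteq> C) \<and>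
          (\<forall>D. D \<in> nonconstant_classes f (p ^ m) \<and> D \<subseteq> C \<longrightarrow>
            min_val f D = ereal (of_int \<alpha> + of_nat l * of_nat (m - m0))))))"
proof -
  obtain M where M: "\<And>a. nonconstant_class f (cong_class a (p ^ M)) \<Longrightarrow>
      \<exists>\<beta> l x. l > 0 \<and> x \<in> padic_ints \<and> affine_val_on f (cong_class a (p ^ M)) \<beta> l x"
    using locally_analytic_affine_level[OF f] unfolding p by blast
  \<comment> \<open>The successor only ensures that \<open>m0\<close> is positive, as
    \<open>M\<close> may be 0.\<close>
  define m0 where "m0 = Suc M"
  let ?N = "\<lambda>m. nonconstant_classes f (p ^ m)"
  have sub: "cong_class a (p ^ m') \<subseteq> cong_class a (p ^ m)" if "m \<le> m'" for a m m'
    using that by (intro cong_class_antimono le_imp_power_dvd)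
  have "\<exists>\<beta> l x. l > 0 \<and> x \<in> padic_ints \<and> affine_val_on f C \<beta> l x \<and> C = int_ball x m0"
    if C: "C \<in> ?N m0" for C
  proof -
    obtain a where a: "C = cong_class a (p ^ m0)" "nonconstant_class f C"
      using C by (auto simp: nonconstant_classes_def)
    have s: "C \<subseteq> cong_class a (p ^ M)" unfolding a(1) by (rule sub) (simp add: m0_def)
    obtain \<beta> l x where "l > 0" "x \<in> padic_ints" "affine_val_on f (cong_class a (p ^ M)) \<beta> l x"
      using M nonconstant_class_mono[OF a(2) s] by blast
    moreover from this have "affine_val_on f C \<beta> l x" using affine_val_on_mono s by blast
    ultimately show ?thesis using nonconstant_affine_class_is_ball a unfolding p by blast
  qed
  \<comment> \<open>The data are chosen once for each class of level \<open>m0\<close>; all deeper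
    levels reuse the same centre, slope and offset.\<close>
  then obtain B L X where BLX: "\<And>C. C \<in> ?N m0 \<Longrightarrow>
      L C > 0 \<and> X C \<in> padic_ints \<and> affine_val_on f C (B C) (L C) (X C) \<and> C = int_ball (X C) m0"
    by metis
  have ball_sub: "int_ball (X C) m \<subseteq> C" if "C \<in> ?N m0" "m \<ge> m0" for C m
    using BLX[OF that(1)] int_ball_antimono[OF that(2)] by metis
  have aff: "affine_val_on f (int_ball (X C) m) (B C) (L C) (X C)" if "C \<in> ?N m0" "m \<ge> m0" for C m
    using affine_val_on_mono ball_sub[OF that] BLX[OF that(1)] by blast
  have ball_in: "int_ball (X C) m \<in> ?N m" if "C \<in> ?N m0" "m \<ge> m0" for C m
  proof -
    have "X C \<in> padic_ints" "L C > 0" using BLX[OF that(1)] by auto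
    moreover from this obtain a where "a \<in> int_ball (X C) m" using int_ball_nonempty by blast
    ultimately show ?thesis
      using nonconstant_class_affine[OF _ aff[OF that]] int_ball_eq_cong_class
      unfolding nonconstant_classes_def p by blast
  qed
  have above: "\<exists>C\<in>?N m0. D \<subseteq> C" if D: "D \<in> ?N m" and m: "m \<ge> m0" for D m
  proof -
    obtain a where a: "D = cong_class a (p ^ m)" "nonconstant_class f D"
      using D unfolding nonconstant_classes_def by blast
    have s: "D \<subseteq> cong_class a (p ^ m0)" unfolding a(1) by (rule sub[OF m])
    moreover have "cong_class a (p ^ m0) \<in> ?N m0"
      using nonconstant_class_mono[OF a(2) s] unfolding nonconstant_classes_def by blast
    ultimately show ?thesis by blast
  qed
  \<comment> \<open>The affine formula of \<open>C\<close> restricts to \<open>D\<close>, so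
    \<open>D\<close> must be the ball of level \<open>m\<close> around the centre of
    \<open>C\<close>. This gives uniqueness inside \<open>C\<close>.\<close>
  have below: "D = int_ball (X C) m" if D: "D \<in> ?N m" and C: "C \<in> ?N m0" and "D \<subseteq> C" for C D m
  proof -
    obtain a where a: "D = cong_class a (p ^ m)" "nonconstant_class f D"
      using D unfolding nonconstant_classes_def by blast
    moreover have "affine_val_on f D (B C) (L C) (X C)"
      using BLX[OF C] affine_val_on_mono \<open>D \<subseteq> C\<close> by blast
    ultimately show ?thesis using nonconstant_affine_class_is_ball unfolding p by blast
  qed
  \<comment> \<open>Shrinking each ball around its centre is a bijection between nonconstant classes
    of levels \<open>m0\<close> and \<open>m\<close>. It is injective because two classes modulo
    p^m0 with a common element coincide.\<close>
  have card: "card (?N m) = card (?N m0)" if m: "m \<ge> m0" for m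
  proof -
    have "?N m = (\<lambda>C. int_ball (X C) m) ` ?N m0"
      using above[OF _ m] below ball_in[OF _ m] by blast
    moreover have "inj_on (\<lambda>C. int_ball (X C) m) (?N m0)"
    proof (rule inj_onI)
      fix C C' assume CC: "C \<in> ?N m0" "C' \<in> ?N m0" "int_ball (X C) m = int_ball (X C') m"
      obtain n where "n \<in> int_ball (X C) m" using int_ball_nonempty BLX[OF CC(1)] by blast
      hence "n \<in> C" "n \<in> C'" using ball_sub CC m by blast+
      moreover have "C = int_ball (X C) m0" "C' = int_ball (X C') m0" using BLX CC by blast+
      ultimately have "C = cong_class n (p ^ m0)" "C' = cong_class n (p ^ m0)"
        unfolding p by (metis int_ball_eq_cong_class)+
      thus "C = C'" by simp
    qed
    ultimately show ?thesis by (simp add: card_image)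
  qed
  have split: "\<exists>a :: nat \<Rightarrow> int.
      D = (\<Union>i<p. cong_class (a i) (p ^ (m + 1))) \<and>
      disjoint_family_on (\<lambda>i. cong_class (a i) (p ^ (m + 1))) {..<p} \<and>
      (\<forall>i\<in>{1..<p}. constant_class f (cong_class (a i) (p ^ (m + 1))) (min_val f D)) \<and>
      nonconstant_class f (cong_class (a 0) (p ^ (m + 1))) \<and>
      min_val f (cong_class (a 0) (p ^ (m + 1))) > min_val f D"
    if D: "D \<in> ?N m" and m: "m \<ge> m0" for D m
  proof -
    obtain C where C: "C \<in> ?N m0" "D \<subseteq> C" using above[OF D m] by blast
    show ?thesis
      unfolding below[OF D C] p using BLX[OF C(1)] aff[OF C(1) m] by (intro int_ball_split) auto
  qed
  have formula: "\<exists>(\<beta>::int) (l::nat). \<exists>x0\<in>(padic_ints :: 'p padic set). l > 0 \<and>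
      (\<forall>n\<in>C. padic_val (f (of_int n)) =
        ereal (of_int \<beta>) + ereal (of_nat l) * padic_val (of_int n - x0))" if "C \<in> ?N m0" for C
    using BLX[OF that] unfolding affine_val_on_def by blast
  have min: "\<exists>(\<alpha>::int) (l::nat). l > 0 \<and>
      (\<forall>m\<ge>m0. (\<exists>!D. D \<in> ?N m \<and> D \<subseteq> C) \<and>
        (\<forall>D. D \<in> ?N m \<and> D \<subseteq> C \<longrightarrow> min_val f D = ereal (of_int \<alpha> + of_nat l * of_nat (m - m0))))"
    if C: "C \<in> ?N m0" for C
  \<comment> \<open>This \<alpha> is the affine formula evaluated at \<open>m0\<close>, so that
    adding l * (m - m0) gives its value at \<open>m\<close>.\<close>
  proof (intro exI[of _ "B C + int (L C) * int m0"] exI[of _ "L C"] conjI allI impI)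
    fix m assume m: "m \<ge> m0"
    show "\<exists>!D. D \<in> ?N m \<and> D \<subseteq> C"
      using ball_in[OF C m] ball_sub[OF C m] below[OF _ C] by blast
    fix D assume D: "D \<in> ?N m \<and> D \<subseteq> C"
    have "min_val f D = ereal (of_int (B C) + real (L C) * real m)"
      using below[OF _ C] D BLX[OF C] min_val_affine[OF _ aff[OF C m]] by blast
    thus "min_val f D = ereal (of_int (B C + int (L C) * int m0) + of_nat (L C) * of_nat (m - m0))"
      using m by (simp add: of_nat_diff algebra_simps)
  qed (use BLX[OF C] in blast)
  show ?thesis
  proof (rule exI[of _ m0], rule exI[of _ "card (?N m0)"], intro conjI allI impI ballI)
    show "m0 > 0" by (simp add: m0_def)
  qed (rule card split formula min; assumption)+
qed

end
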